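(* Let $0<\beta<1$ and $0<\gamma\le1$ with $\beta+\gamma>1$, let $\lambda=\lambda_{1,\beta,\gamma}$ be the generalized hyperbolic density on $\mathbb{C}\setminus\{0,1\}$ of order $\alpha=1$ at $0$ given by the explicit formula in the context, with $a=\frac{1+\beta-\gamma}2$ and $b=\frac{\beta+\gamma-1}2$, and let $$w(z)=\log\lambda(z)+\log|z|+\log\log(1/|z|),\qquad 0<|z|<1,$$ be its remainder function near the origin. Then for all integers $m,n\ge1$: (i) $\displaystyle\lim_{z\to0}z^n\log^2(1/|z|)\,\partial^nw(z)=\frac{(-1)^n(n-1)!}{4}\,(G(a)+G(b))$; (ii) $\displaystyle\lim_{z\to0}z^n\bar z^m\log^3(1/|z|)\,\bar\partial^m\partial^nw(z)=\frac{(-1)^{m+n-1}(n-1)!\,(m-1)!}{4}\,(G(a)+G(b))$, where $G(x)=2\Psi(1)-\Psi(x)-\Psi(1-x)$ for $0<x<1$.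
   Context: Notation: $\partial^n=\partial^n/\partial z^n$ and $\bar\partial^n=\partial^n/\partial\bar z^n$ are Wirtinger derivatives; $\Gamma$ is the gamma function, $\Psi=\Gamma'/\Gamma$ the digamma function, $B(a,b)=\Gamma(a)\Gamma(b)/\Gamma(a+b)$ the beta function; $(x)_0=1$ and $(x)_n=x(x+1)\cdots(x+n-1)$ for $n\ge1$; $F(a,b,c;z)=\sum_{n\ge0}\frac{(a)_n(b)_n}{(c)_n}\frac{z^n}{n!}$ for $|z|<1$ is the Gaussian hypergeometric function, continued analytically to $\mathbb{C}\setminus[1,+\infty)$; $\log^k(1/|z|)$ means $(\log(1/|z|))^k$. For $0<\beta<1$, $0<\gamma\le1$, $\beta+\gamma>1$, with $a=\frac{1+\beta-\gamma}2$ and $b=\frac{\beta+\gamma-1}2$, put $$K_3=\frac1{B(a,b)},\qquad S=\frac{\pi\sin(\pi(a+b))}{\sin(\pi a)\sin(\pi b)},\qquad K_1=-\frac{S}{B(a,b)},$$ $$\varphi_1(z)=F(a,b,1;z),\qquad \varphi_2(z)=F(a,b,a+b;1-z).$$ The generalized hyperbolic density (Gaussian curvature $-4$) of orders $1,\beta,\gamma$ at $0,1,\infty$ is $$\lambda_{1,\beta,\gamma}(z)=\frac1{|z|}\frac1{|1-z|^\beta}\cdot\frac{K_3}{K_1|\varphi_1(z)|^2+\varphi_1(z)\varphi_2(\bar z)+\varphi_1(\bar z)\varphi_2(z)},\qquad z\in\mathbb{C}\setminus\{0,1\},$$ where $\varphi_1$ is analytic in $\mathbb{C}\setminus[1,+\infty)$,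 $\varphi_2$ is analytic in $\mathbb{C}\setminus(-\infty,0]$, and on the slits $(-\infty,0)$ and $(1,+\infty)$ the expression is understood through its smooth (continuous) extension. *)

theory Defs
  imports "HOL-Complex_Analysis.Complex_Analysis"
begin

text \<open>
  The principal branch of the Gaussian hypergeometric function: the analytic continuation to
  the plane slit along \<open>[1,+\<infinity>)\<close> of the power series
  \<open>\<Sum>n. (a)_n (b)_n / (c)_n * z^n / n!\<close>.  The slit plane is connected, so the
  function chosen below is unique there.  Values on the slit are unspecified.
\<close>

definition hypergeo_F :: "complex \<Rightarrow> complex \<Rightarrow> complex \<Rightarrow> complex \<Rightarrow> complex" where
  "hypergeo_F a b c =
     (SOME f. f holomorphic_on (- complex_of_real ` {1..}) \<and>
              (\<forall>z. norm z < 1 \<longrightarrow> f z = eval_fps (fps_hypergeo [a, b] [c] 1) z))"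

text \<open>
  The closed expression for the density of orders \<open>1, \<beta>, \<gamma>\<close> at
  \<open>0, 1, \<infinity>\<close>, valid off the two slits.  The power series have real
  coefficients, so \<open>\<phi>1 (cnj z) = cnj (\<phi>1 z)\<close>, likewise for \<open>\<phi>2\<close>, and
  the denominator is a real number; \<open>Re\<close> only changes its type.
\<close>

definition hyperbolic_density_formula :: "real \<Rightarrow> real \<Rightarrow> complex \<Rightarrow> real" where
  "hyperbolic_density_formula \<beta> \<gamma> z =
    (let a = (1 + \<beta> - \<gamma>) / 2;
         b = (\<beta> + \<gamma> - 1) / 2;
         K3 = 1 / Beta a b;
         S = pi * sin (pi * (a + b)) / (sin (pi * a) * sin (pi * b));
         K1 = - S / Beta a b;
         \<phi>1 = (\<lambda>u. hypergeo_F (of_real a) (of_real b) 1 u);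
         \<phi>2 = (\<lambda>u. hypergeo_F (of_real a) (of_real b) (of_real (a + b)) (1 - u))
     in 1 / norm z * (1 / norm (1 - z) powr \<beta>) *
        (K3 / Re (of_real (K1 * (norm (\<phi>1 z))\<^sup>2) + \<phi>1 z * \<phi>2 (cnj z) + \<phi>1 (cnj z) * \<phi>2 z)))"

definition density_slits :: "complex set" where
  "density_slits = complex_of_real ` ({..0} \<union> {1..})"

text \<open>
  On the open slits \<open>(-\<infinity>,0)\<close> and \<open>(1,+\<infinity>)\<close> the density is the
  continuous extension of the formula.  The values at \<open>0\<close> and \<open>1\<close> have no meaning.
\<close>

definition hyperbolic_density_1 :: "real \<Rightarrow> real \<Rightarrow> complex \<Rightarrow> real" where
  "hyperbolic_density_1 \<beta> \<gamma> z =
    (if z \<in> density_slits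
     then Lim (at z within - density_slits) (hyperbolic_density_formula \<beta> \<gamma>)
     else hyperbolic_density_formula \<beta> \<gamma> z)"

text \<open>Only the values for \<open>0 < norm z < 1\<close> are meaningful.\<close>

definition remainder_w :: "real \<Rightarrow> real \<Rightarrow> complex \<Rightarrow> real" where
  "remainder_w \<beta> \<gamma> z = ln (hyperbolic_density_1 \<beta> \<gamma> z) + ln (norm z) + ln (ln (1 / norm z))"

definition partial_x :: "(complex \<Rightarrow> complex) \<Rightarrow> complex \<Rightarrow> complex" where
  "partial_x f z = vector_derivative (\<lambda>t. f (z + of_real t)) (at 0)"

definition partial_y :: "(complex \<Rightarrow> complex) \<Rightarrow> complex \<Rightarrow> complex" where
  "partial_y f z = vector_derivative (\<lambda>t. f (z + \<i> * of_real t)) (at 0)"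

definition wirtinger :: "(complex \<Rightarrow> complex) \<Rightarrow> complex \<Rightarrow> complex" where
  "wirtinger f z = (partial_x f z - \<i> * partial_y f z) / 2"

definition wirtinger_bar :: "(complex \<Rightarrow> complex) \<Rightarrow> complex \<Rightarrow> complex" where
  "wirtinger_bar f z = (partial_x f z + \<i> * partial_y f z) / 2"

definition G_fun :: "real \<Rightarrow> real" where
  "G_fun x = 2 * Digamma 1 - Digamma x - Digamma (1 - x)"

end

theory Submission
  imports Defs "HOL-Real_Asymp.Real_Asymp"
begin

text \<open>
  Write \<open>L = log (1/|z|)\<close>.  Everything rests on the logarithmic connection formula at the origin:
  \<open>B(a,b) \<phi>2 = \<phi>1 (-Ln z + g)\<close> with \<open>g\<close> holomorphic near \<open>0\<close> and
  \<open>g(0) = 2 \<Psi>(1) - \<Psi>(a) - \<Psi>(b)\<close>.  Inserted into the denominator of the density, the two mixed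
  products add up to \<open>2 Re (cnj \<phi>1 \<phi>2)\<close>, the argument of \<open>z\<close> disappears, and the denominator
  becomes \<open>2 |\<phi>1|^2 M / B(a,b)\<close> with \<open>M = L + Re Q\<close> and \<open>Q = g - S/2\<close>.  By the reflection formula for
  \<open>\<Psi>\<close>, \<open>S = \<Psi>(1-a) - \<Psi>(a) + \<Psi>(1-b) - \<Psi>(b)\<close>, so that \<open>Re (Q 0) = (G(a) + G(b)) / 2\<close>.  Hence
  \<open>w = H + log L - log M\<close>, where \<open>H\<close> is the sum of a holomorphic and an antiholomorphic function
  (lemma \<open>remainder_w_decomposition\<close>).

  The connection formula is obtained without Frobenius series.  Both \<open>\<phi>1\<close> and \<open>\<phi>2\<close> solve the
  hypergeometric equation, whose Wronskian is explicit up to a constant; integrating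
  \<open>(\<phi>2/\<phi>1)' = W/\<phi>1^2\<close> shows that \<open>\<phi>2/\<phi>1\<close> is \<open>C Ln z\<close> plus a holomorphic function
  (\<open>logarithmic_second_solution\<close>).  The constants \<open>C\<close> and \<open>g(0)\<close> are then read off from the behaviour
  of the power series of \<open>F(a,b;a+b;1-x)\<close> as \<open>x\<close> decreases to \<open>0\<close> (\<open>log_asymptotics_at_one\<close>), which an
  elementary telescoping argument in the parameter \<open>a\<close> provides.  That the hypergeometric
  series has a continuation to the slit plane at all is Euler's integral representation.

  For the derivatives put \<open>X = 1/M\<close>, \<open>Y = 1/L\<close>, \<open>\<theta> = z \<partial>\<close> and \<open>\<theta>' = cnj z \<partial>'\<close>, where \<open>\<partial>'\<close> is the
  other Wirtinger derivative.  Then \<open>\<theta> Y = Y^2/2\<close> and \<open>\<theta> X = -p X^2\<close> with \<open>p\<close> holomorphic and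
  \<open>p(0) = -1/2\<close>; hence \<open>\<theta>\<close> and \<open>\<theta>'\<close> raise the total degree in \<open>X, Y\<close> by one, up to terms
  whose coefficient vanishes at \<open>0\<close>, and such terms are smaller than every power of \<open>Y\<close>.  The functions
  \<open>G_n = z^n \<partial>^n w\<close> satisfy \<open>G_{n+1} = \<theta> G_n - n G_n\<close>, and \<open>\<theta> G_n\<close> is of higher order, so that
  \<open>G_n = (-1)^(n-1) (n-1)! G_1\<close> to leading order; likewise for \<open>\<theta>'\<close>.  Because of
  \<open>Y - X = Re Q X Y\<close>, the leading term of \<open>G_1\<close> is \<open>-Re (Q 0) X Y / 2\<close>, and that of \<open>\<theta>' G_1\<close> is
  \<open>-Re (Q 0) (X^2 Y + X Y^2) / 4\<close>.  Multiplication by \<open>L^2\<close> or \<open>L^3\<close> gives the two limits.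
\<close>


section \<open>Euler's integral and the slit plane\<close>

text \<open>
  The weight may be unbounded at the endpoints, so that continuity of the integrand is not
  available; the continuous factor is bounded on the compact interval and can be dominated.
\<close>

lemma set_integrable_weighted:
  fixes \<rho> :: "real \<Rightarrow> real" and f :: "real \<Rightarrow> complex"
  assumes \<rho>: "set_integrable lborel {0..1} \<rho>" and f: "continuous_on {0..1} f"
  shows "set_integrable lborel {0..1} (\<lambda>t. \<rho> t *\<^sub>R f t)"
proof -
  obtain B where B: "\<And>t. t \<in> {0..1} \<Longrightarrow> norm (f t) \<le> B"
    using compact_imp_bounded[OF compact_continuous_image[OF f compact_Icc]]
    unfolding bounded_iff by blast
  have m1: "(\<lambda>t. indicator {0..1} t *\<^sub>R f t) \<in> borel_measurable lborel"
    using borel_measurable_continuous_on_indicator[OF _ f] by simp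
  have m2: "(\<lambda>t. indicator {0..1} t *\<^sub>R \<rho> t) \<in> borel_measurable lborel"
    using \<rho> unfolding set_integrable_def by (rule borel_measurable_integrable)
  have eq: "indicator {0..1} t *\<^sub>R \<rho> t *\<^sub>R f t =
      (indicator {0..1} t *\<^sub>R \<rho> t) *\<^sub>R (indicator {0..1} t *\<^sub>R f t)" for t :: real
    by (auto simp: indicator_def)
  show ?thesis
    unfolding set_integrable_def
  proof (rule Bochner_Integration.integrable_bound)
    show "integrable lborel (\<lambda>t. B * (indicator {0..1} t *\<^sub>R \<rho> t))"
      using \<rho> unfolding set_integrable_def by (intro integrable_mult_right)
    show "(\<lambda>t. indicator {0..1} t *\<^sub>R \<rho> t *\<^sub>R f t) \<in> borel_measurable lborel"
      unfolding eq by (rule borel_measurable_scaleR[OF m2 m1])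
    show "AE t in lborel. norm (indicator {0..1} t *\<^sub>R \<rho> t *\<^sub>R f t)
             \<le> norm (B * (indicator {0..1} t *\<^sub>R \<rho> t))"
    proof (rule AE_I2)
      fix t :: real
      show "norm (indicator {0..1} t *\<^sub>R \<rho> t *\<^sub>R f t)
             \<le> norm (B * (indicator {0..1} t *\<^sub>R \<rho> t))"
      proof (cases "t \<in> {0..1}")
        case True
        have "\<bar>\<rho> t\<bar> * norm (f t) \<le> \<bar>\<rho> t\<bar> * \<bar>B\<bar>"
          by (intro mult_left_mono) (use B[OF True] in auto)
        then show ?thesis using True by (simp add: abs_mult mult.commute)
      qed simp
    qed
  qed
qed

text \<open>
  Differentiation under the integral sign.  The difference quotients of the kernel are bounded
  locally uniformly, since \<open>k'\<close> is bounded on compact sets, and the weight is integrable; dominated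
  convergence does the rest.
\<close>

lemma holomorphic_on_weighted_integral:
  fixes k k' :: "complex \<Rightarrow> real \<Rightarrow> complex" and \<rho> :: "real \<Rightarrow> real"
  assumes U: "open U" and \<rho>: "set_integrable lborel {0..1} \<rho>"
    and k: "continuous_on (U \<times> {0..1}) (\<lambda>(z, t). k z t)"
    and k': "continuous_on (U \<times> {0..1}) (\<lambda>(z, t). k' z t)"
    and der: "\<And>z t. z \<in> U \<Longrightarrow> t \<in> {0..1} \<Longrightarrow>
                ((\<lambda>z. k z t) has_field_derivative k' z t) (at z)"
  shows "(\<lambda>z. LINT t:{0..1}|lborel. \<rho> t *\<^sub>R k z t) holomorphic_on U"
proof -
  define F where "F = (\<lambda>z. LINT t:{0..1}|lborel. \<rho> t *\<^sub>R k z t)"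
  have kc: "continuous_on {0..1} (k z)" if "z \<in> U" for z
    using continuous_on_compose2[OF k, of "{0..1}" "\<lambda>t. (z, t)"] that
    by (simp add: continuous_on_Pair image_subset_iff)
  have kc': "continuous_on {0..1} (k' z)" if "z \<in> U" for z
    using continuous_on_compose2[OF k', of "{0..1}" "\<lambda>t. (z, t)"] that
    by (simp add: continuous_on_Pair image_subset_iff)
  have "\<exists>D. (F has_field_derivative D) (at z0)" if z0: "z0 \<in> U" for z0
  proof -
    obtain e where e: "e > 0" "cball z0 e \<subseteq> U"
      using U z0 open_contains_cball by blast
    have "compact ((\<lambda>(z, t). k' z t) ` (cball z0 e \<times> {0..1}))"
      using e by (intro compact_continuous_image continuous_on_subset[OF k'] compact_Times) auto
    from compact_imp_bounded[OF this] obtain B where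
      B: "\<And>z t. z \<in> cball z0 e \<Longrightarrow> t \<in> {0..1} \<Longrightarrow> norm (k' z t) \<le> B"
      unfolding bounded_iff by fastforce
    define D where "D = (LINT t:{0..1}|lborel. \<rho> t *\<^sub>R k' z0 t)"
    have lip: "norm (k z t - k z0 t) \<le> B * norm (z - z0)" if "z \<in> cball z0 e" "t \<in> {0..1}" for z t
    proof (rule field_differentiable_bound[of "cball z0 e" "\<lambda>z. k z t" "\<lambda>z. k' z t"])
      show "((\<lambda>z. k z t) has_field_derivative k' z t) (at z within cball z0 e)"
        if "z \<in> cball z0 e" for z
        by (rule has_field_derivative_at_within[OF der]) (use that e \<open>t \<in> {0..1}\<close> in blast)+
    qed (use that e B in auto)
    \<comment> \<open>Sequences suffice, and restricting
      them to the ball keeps all their members inside the region of domination.\<close>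
    have "((\<lambda>z. (F z - F z0) / (z - z0)) \<longlongrightarrow> D) (at z0 within ball z0 e)"
      unfolding tendsto_at_iff_sequentially comp_def
    proof (intro allI impI)
      fix X :: "nat \<Rightarrow> complex"
      assume X: "\<forall>i. X i \<in> ball z0 e - {z0}" and lim: "X \<longlonglongrightarrow> z0"
      have XU: "X i \<in> U" "X i \<in> cball z0 e" "X i \<noteq> z0" for i
        using X e(2) ball_subset_cball by blast+
      define s where "s = (\<lambda>i t. indicator {0..1} t *\<^sub>R \<rho> t *\<^sub>R ((k (X i) t - k z0 t) / (X i - z0)))"
      have int1: "integrable lborel (s i)" for i
        using set_integrable_weighted[OF \<rho>, of "\<lambda>t. (k (X i) t - k z0 t) / (X i - z0)"]
          continuous_on_divide[OF continuous_on_diff[OF kc[OF XU(1)[of i]] kc[OF z0]] continuous_on_const]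
          XU(3)[of i]
        unfolding set_integrable_def s_def by simp
      have s_eq: "integral\<^sup>L lborel (s i) = (F (X i) - F z0) / (X i - z0)" for i
      proof -
        have "s i = (\<lambda>t. (indicator {0..1} t *\<^sub>R \<rho> t *\<^sub>R k (X i) t
              - indicator {0..1} t *\<^sub>R \<rho> t *\<^sub>R k z0 t) / (X i - z0))"
          unfolding s_def by (auto simp: scaleR_conv_of_real algebra_simps diff_divide_distrib)
        then show ?thesis
          unfolding F_def set_lebesgue_integral_def
          using set_integrable_weighted[OF \<rho> kc[OF z0]] set_integrable_weighted[OF \<rho> kc[OF XU(1)]]
          unfolding set_integrable_def by simp
      qed
      have "(\<lambda>i. integral\<^sup>L lborel (s i)) \<longlonglongrightarrow> D"
        unfolding D_def set_lebesgue_integral_def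
      proof (rule integral_dominated_convergence)
        show "(\<lambda>t. indicator {0..1} t *\<^sub>R \<rho> t *\<^sub>R k' z0 t) \<in> borel_measurable lborel"
          using set_integrable_weighted[OF \<rho> kc'[OF z0]] unfolding set_integrable_def
          by (rule borel_measurable_integrable)
        show "s i \<in> borel_measurable lborel" for i
          using int1 by (rule borel_measurable_integrable)
        show "integrable lborel (\<lambda>t. B * norm (indicator {0..1} t *\<^sub>R \<rho> t))"
          using \<rho> unfolding set_integrable_def by (intro integrable_mult_right integrable_norm)
        show "AE t in lborel. (\<lambda>i. s i t) \<longlonglongrightarrow> indicator {0..1} t *\<^sub>R \<rho> t *\<^sub>R k' z0 t"
        proof (rule AE_I2)
          fix t :: real
          show "(\<lambda>i. s i t) \<longlonglongrightarrow> indicator {0..1} t *\<^sub>R \<rho> t *\<^sub>R k' z0 t"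
          proof (cases "t \<in> {0..1}")
            case True
            have "((\<lambda>z. (k z t - k z0 t) / (z - z0)) \<longlongrightarrow> k' z0 t) (at z0 within UNIV)"
              using der[OF z0 True] by (simp add: has_field_derivative_iff)
            then have "(\<lambda>i. (k (X i) t - k z0 t) / (X i - z0)) \<longlonglongrightarrow> k' z0 t"
              unfolding tendsto_at_iff_sequentially comp_def using lim XU(3) by blast
            then show ?thesis unfolding s_def by (intro tendsto_intros)
          qed (simp add: s_def)
        qed
        show "AE t in lborel. norm (s i t) \<le> B * norm (indicator {0..1} t *\<^sub>R \<rho> t)" for i
        proof (rule AE_I2)
          fix t :: real
          show "norm (s i t) \<le> B * norm (indicator {0..1} t *\<^sub>R \<rho> t)"
          proof (cases "t \<in> {0..1}")
            case True
            have "norm ((k (X i) t - k z0 t) / (X i - z0)) \<le> B"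
              using lip[OF XU(2) True] XU(3)[of i] by (simp add: norm_divide divide_simps)
            then have "\<bar>\<rho> t\<bar> * norm ((k (X i) t - k z0 t) / (X i - z0)) \<le> \<bar>\<rho> t\<bar> * B"
              by (intro mult_left_mono) auto
            then show ?thesis using True by (simp add: s_def mult.commute)
          qed (simp add: s_def)
        qed
      qed
      then show "(\<lambda>i. (F (X i) - F z0) / (X i - z0)) \<longlonglongrightarrow> D" unfolding s_eq .
    qed
    then show ?thesis
      using e by (auto simp: has_field_derivative_iff at_within_open[of z0 "ball z0 e"])
  qed
  then show ?thesis
    unfolding F_def[symmetric] holomorphic_on_open[OF U] by blast
qed

text \<open>
  For these \<open>z\<close> and \<open>t\<close> the principal branch of \<open>(1 - z t) powr s\<close> stays off its cut.
\<close>

lemma one_minus_mult_notin_nonpos_Reals: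
  assumes z: "z \<in> - complex_of_real ` {1..}" and t: "t \<in> {0..1}"
  shows "1 - z * of_real t \<notin> \<real>\<^sub>\<le>\<^sub>0"
proof
  assume "1 - z * of_real t \<in> \<real>\<^sub>\<le>\<^sub>0"
  then obtain x where x: "x \<le> 0" "1 - z * of_real t = of_real x"
    by (auto elim: nonpos_Reals_cases)
  have t0: "t > 0" using x t by (cases "t = 0") auto
  have "z = of_real ((1 - x) / t)"
    using x(2) t0 by (auto simp: field_simps)
  moreover have "(1 - x) / t \<ge> 1" using x(1) t t0 by (simp add: divide_simps)
  ultimately show False using z by blast
qed

lemma branch_cut_eq: "complex_of_real ` {1..} = {z. Im z = 0 \<and> Re z \<ge> 1}"
proof (intro equalityI subsetI)
  fix z assume "z \<in> {z. Im z = 0 \<and> Re z \<ge> 1}"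
  then show "z \<in> complex_of_real ` {1..}"
    by (intro image_eqI[of _ _ "Re z"]) (auto simp: complex_eq_iff)
qed auto

lemma open_slit_plane: "open (- complex_of_real ` {1..})"
  unfolding branch_cut_eq open_closed double_complement
  by (intro closed_Collect_conj closed_Collect_eq closed_Collect_le continuous_intros)

lemma connected_slit_plane: "connected (- complex_of_real ` {1..})"
proof (intro starlike_imp_connected)
  have *: "u *\<^sub>R z \<in> - complex_of_real ` {1..}"
    if "z \<in> - complex_of_real ` {1..}" "0 \<le> u" "u \<le> 1" for z and u :: real
  proof -
    have False if "u * Im z = 0" "u * Re z \<ge> 1" "\<not> (Im z = 0 \<and> Re z \<ge> 1)"
    proof -
      have u: "u > 0" using that(2) \<open>0 \<le> u\<close> by (cases "u = 0") auto
      with that have "Re z < 1" "Im z = 0" by auto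
      from mult_strict_left_mono[OF this(1) u] \<open>u * Re z \<ge> 1\<close> \<open>u \<le> 1\<close> show False by simp
    qed
    with that show ?thesis unfolding branch_cut_eq by auto
  qed
  have "closed_segment 0 z \<subseteq> - complex_of_real ` {1..}"
    if "z \<in> - complex_of_real ` {1..}" for z
  proof
    fix x assume "x \<in> closed_segment 0 z"
    then obtain u where u: "0 \<le> u" "u \<le> 1" "x = u *\<^sub>R z"
      unfolding closed_segment_def by auto
    show "x \<in> - complex_of_real ` {1..}" unfolding u(3) by (rule *[OF that u(1,2)])
  qed
  moreover have "0 \<in> - complex_of_real ` {1..}" by auto
  ultimately show "starlike (- complex_of_real ` {1..})"
    unfolding starlike_def by blast
qed

definition euler_kernel_weight :: "real \<Rightarrow> real \<Rightarrow> real \<Rightarrow> real" where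
  "euler_kernel_weight b d t = t powr (b - 1) * (1 - t) powr (d - 1)"

lemma set_integrable_euler_kernel_weight:
  "b > 0 \<Longrightarrow> d > 0 \<Longrightarrow> set_integrable lborel {0..1} (euler_kernel_weight b d)"
  unfolding euler_kernel_weight_def[abs_def] by (rule integrable_Beta)

lemma moment_euler_kernel_weight:
  assumes "b > 0" "d > 0"
  shows "(LINT t:{0..1}|lborel. euler_kernel_weight b d t * t ^ n) = Beta (b + real n) d"
proof -
  have pw: "euler_kernel_weight b d t * t ^ n = euler_kernel_weight (b + real n) d t"
    if "t \<in> {0..1}" for t
  proof (cases "t = 0")
    case True
    then show ?thesis using assms by (cases n) (auto simp: euler_kernel_weight_def)
  next
    case False
    with that have "t powr (b - 1) * t ^ n = t powr (b + real n - 1)"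
      by (simp add: powr_realpow[symmetric] powr_add[symmetric] algebra_simps)
    then show ?thesis by (simp add: euler_kernel_weight_def mult_ac)
  qed
  have "(LINT t:{0..1}|lborel. euler_kernel_weight b d t * t ^ n)
        = (LINT t:{0..1}|lborel. euler_kernel_weight (b + real n) d t)"
    unfolding set_lebesgue_integral_def
    by (intro Bochner_Integration.integral_cong refl) (auto simp: indicator_def pw)
  also have "\<dots> = integral {0..1} (euler_kernel_weight (b + real n) d)"
    using assms by (intro set_borel_integral_eq_integral set_integrable_euler_kernel_weight) auto
  also have "\<dots> = Beta (b + real n) d"
    unfolding euler_kernel_weight_def[abs_def] using assms
    by (intro integral_unique has_integral_Beta_real) auto
  finally show ?thesis .
qed

lemma Beta_shift_eq:
  assumes "b > 0" "d > (0::real)"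
  shows "Beta (b + real n) d = Beta b d * pochhammer b n / pochhammer (b + d) n"
proof (induction n)
  case (Suc n)
  have "(b + real n + d) * Beta (b + real n + 1) d = (b + real n) * Beta (b + real n) d"
    using assms by (intro Beta_plus1_left) (auto elim!: nonpos_Ints_cases)
  then have "Beta (b + real n + 1) d = (b + real n) * Beta (b + real n) d / (b + real n + d)"
    using assms by (simp add: field_simps)
  then show ?case using Suc
    by (simp add: pochhammer_Suc mult_ac add_ac)
qed simp

lemma Beta_real_pos: "0 < a \<Longrightarrow> 0 < b \<Longrightarrow> Beta a b > (0::real)"
  by (simp add: Beta_def Gamma_real_pos)

text \<open>
  Euler's representation of \<open>F(a,b;c;z)\<close>.  It makes sense for \<open>0 < b < c\<close>, and both parameter triples
  of the density, \<open>(a,b;1)\<close> and \<open>(a,b;a+b)\<close>, are of this kind.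
\<close>

definition euler_integral :: "real \<Rightarrow> real \<Rightarrow> real \<Rightarrow> complex \<Rightarrow> complex" where
  "euler_integral a b c z = (LINT t:{0..1}|lborel.
      euler_kernel_weight b (c - b) t *\<^sub>R (1 - z * of_real t) powr (- of_real a)) / of_real (Beta b (c - b))"

lemma holomorphic_euler_integral:
  assumes "0 < b" "b < c"
  shows "euler_integral a b c holomorphic_on - complex_of_real ` {1..}"
proof -
  have nz: "1 - z * of_real t \<notin> \<real>\<^sub>\<le>\<^sub>0" if "z \<in> - complex_of_real ` {1..}" "t \<in> {0..1}" for z t
    using one_minus_mult_notin_nonpos_Reals that by blast
  have cont: "continuous_on ((- complex_of_real ` {1..}) \<times> {0..1})
      (\<lambda>p. (1 - fst p * of_real (snd p)) powr s)" for s
  proof (rule continuous_on_eq)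
    have nzp: "1 - fst p * of_real (snd p) \<notin> \<real>\<^sub>\<le>\<^sub>0"
      if "p \<in> (- complex_of_real ` {1..}) \<times> {0..1}" for p
      using nz[of "fst p" "snd p"] that unfolding mem_Times_iff by blast
    show "continuous_on ((- complex_of_real ` {1..}) \<times> {0..1})
        (\<lambda>p. exp (s * Ln (1 - fst p * of_real (snd p))))"
      by (intro continuous_intros) (use nzp in blast)
    show "exp (s * Ln (1 - fst p * of_real (snd p))) = (1 - fst p * of_real (snd p)) powr s"
      if "p \<in> (- complex_of_real ` {1..}) \<times> {0..1}" for p
      using nz[of "fst p" "snd p"] that by (auto simp: powr_def)
  qed
  have "(\<lambda>z. LINT t:{0..1}|lborel.
      euler_kernel_weight b (c - b) t *\<^sub>R (1 - z * of_real t) powr (- of_real a))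
      holomorphic_on - complex_of_real ` {1..}"
  proof (rule holomorphic_on_weighted_integral[where
          k' = "\<lambda>z t. (1 - z * of_real t) powr (- of_real a - 1) * of_real a * of_real t"])
    show "set_integrable lborel {0..1} (euler_kernel_weight b (c - b))"
      using assms by (intro set_integrable_euler_kernel_weight) auto
    show "((\<lambda>z. (1 - z * of_real t) powr (- of_real a)) has_field_derivative
        (1 - z * of_real t) powr (- of_real a - 1) * of_real a * of_real t) (at z)"
      if "z \<in> - complex_of_real ` {1..}" "t \<in> {0..1}" for z t
      by (rule derivative_eq_intros refl nz[OF that] | simp)+
    show "continuous_on ((- complex_of_real ` {1..}) \<times> {0..1})
        (\<lambda>(z, t). (1 - z * of_real t) powr (- of_real a))"
      unfolding case_prod_beta
      by (intro continuous_intros cont)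
    show "continuous_on ((- complex_of_real ` {1..}) \<times> {0..1})
        (\<lambda>(z, t). (1 - z * of_real t) powr (- of_real a - 1) * of_real a * of_real t)"
      unfolding case_prod_beta
      by (intro continuous_intros cont)
  qed (rule open_slit_plane)
  moreover have "Beta b (c - b) \<noteq> 0"
    using assms Beta_real_pos[of b "c - b"] by simp
  ultimately show ?thesis
    unfolding euler_integral_def[abs_def] by (intro holomorphic_intros) auto
qed

lemma fps_hypergeo_nth_of_real:
  "fps_nth (fps_hypergeo [complex_of_real a, of_real b] [of_real c] 1) n =
     of_real (pochhammer a n * pochhammer b n / (pochhammer c n * fact n))"
  by (simp add: pochhammer_of_real)

text \<open>
  Expand \<open>(1 - z t) powr (-a)\<close> by the binomial series and integrate term by term; the moments of the
  weight are Beta values, which turn into the quotients of Pochhammer symbols.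
\<close>

lemma euler_integral_sums:
  assumes bc: "0 < b" "b < c" and z: "norm z < 1"
  shows "(\<lambda>n. fps_nth (fps_hypergeo [of_real a, of_real b] [of_real c] 1) n * z ^ n)
           sums euler_integral a b c z"
proof -
  let ?w = "euler_kernel_weight b (c - b)"
  define f where "f = (\<lambda>n t. indicator {0..1} t *\<^sub>R ?w t *\<^sub>R
      (of_real (pochhammer a n / fact n) * (z * of_real t) ^ n :: complex))"
  have w: "set_integrable lborel {0..1} ?w"
    using bc by (intro set_integrable_euler_kernel_weight) auto
  have w0: "?w t \<ge> 0" for t by (simp add: euler_kernel_weight_def)
  have bin: "(\<lambda>n. of_real (pochhammer a n / fact n) * u ^ n) sums (1 - u) powr (- of_real a)"
    if "norm u < 1" for u :: complex
  proof -
    have "((- of_real a) gchoose n) * (- u) ^ n = of_real (pochhammer a n / fact n) * u ^ n" for n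
    proof -
      have "(-1) ^ n * (- u) ^ n = u ^ n" by (simp flip: power_mult_distrib)
      then show ?thesis by (simp add: gbinomial_pochhammer pochhammer_of_real mult_ac)
    qed
    then show ?thesis using gen_binomial_complex[of "-u" "- of_real a"] that by simp
  qed
  have zt: "norm (z * of_real t) \<le> norm z" if "t \<in> {0..1}" for t
    using that by (simp add: norm_mult mult_left_le)
  have abs_bin: "summable (\<lambda>n. \<bar>pochhammer a n / fact n\<bar> * norm z ^ n)"
  proof -
    obtain K where K: "norm z < K" "K < 1" using z dense by blast
    have "summable (\<lambda>n. of_real (pochhammer a n / fact n) * complex_of_real K ^ n)"
      using K norm_ge_zero[of z] by (intro sums_summable[OF bin]) (auto simp del: norm_ge_zero)
    from powser_insidea[OF this, of z] show ?thesis
      using K norm_ge_zero[of z] by (simp add: norm_mult norm_power norm_divide del: norm_ge_zero)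
  qed
  have int: "integrable lborel (f n)" for n
    using set_integrable_weighted[OF w, of "\<lambda>t. of_real (pochhammer a n / fact n) * (z * of_real t) ^ n"]
    unfolding set_integrable_def f_def by (simp add: continuous_intros)
  have bound: "norm (f n t) \<le> \<bar>pochhammer a n / fact n\<bar> * norm z ^ n * (indicator {0..1} t *\<^sub>R ?w t)" for n t
  proof (cases "t \<in> {0..1}")
    case True
    have "norm (z * of_real t) ^ n \<le> norm z ^ n" using zt[OF True] by (intro power_mono) auto
    then have "?w t * (\<bar>pochhammer a n / fact n\<bar> * norm (z * of_real t) ^ n)
       \<le> ?w t * (\<bar>pochhammer a n / fact n\<bar> * norm z ^ n)"
      by (intro mult_left_mono w0) auto
    then show ?thesis using True w0[of t]
      by (simp add: f_def norm_mult norm_power norm_divide mult_ac)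
  qed (simp add: f_def)
  have sums: "(\<lambda>n. integral\<^sup>L lborel (f n)) sums (\<integral>t. (\<Sum>n. f n t) \<partial>lborel)"
  proof (rule sums_integral[OF int])
    show "AE t in lborel. summable (\<lambda>n. norm (f n t))"
      using bound by (intro AE_I2 summable_comparison_test'[OF summable_mult2[OF abs_bin]]) auto
    show "summable (\<lambda>n. \<integral>t. norm (f n t) \<partial>lborel)"
    proof (rule summable_comparison_test'[OF summable_mult2[OF abs_bin]])
      fix n :: nat
      have "(\<integral>t. norm (f n t) \<partial>lborel) \<le>
         (\<integral>t. \<bar>pochhammer a n / fact n\<bar> * norm z ^ n * (indicator {0..1} t *\<^sub>R ?w t) \<partial>lborel)"
        using w unfolding set_integrable_def
        by (intro integral_mono int integrable_norm integrable_mult_right bound)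
      also have "\<dots> = \<bar>pochhammer a n / fact n\<bar> * norm z ^ n *
          (\<integral>t. indicator {0..1} t *\<^sub>R ?w t \<partial>lborel)" by (rule integral_mult_right_zero)
      finally show "norm (\<integral>t. norm (f n t) \<partial>lborel) \<le> \<bar>pochhammer a n / fact n\<bar> * norm z ^ n *
          (\<integral>t. indicator {0..1} t *\<^sub>R ?w t \<partial>lborel)" by simp
    qed
  qed
  have int_sum: "(\<integral>t. (\<Sum>n. f n t) \<partial>lborel) = (LINT t:{0..1}|lborel. ?w t *\<^sub>R (1 - z * of_real t) powr (- of_real a))"
    unfolding set_lebesgue_integral_def
  proof (intro Bochner_Integration.integral_cong refl)
    fix t :: real
    show "(\<Sum>n. f n t) = indicator {0..1} t *\<^sub>R ?w t *\<^sub>R (1 - z * of_real t) powr (- of_real a)"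
    proof (cases "t \<in> {0..1}")
      case True
      have "(\<lambda>n. f n t) sums (?w t *\<^sub>R (1 - z * of_real t) powr (- of_real a))"
        using sums_scaleR_right[OF bin[of "z * of_real t"], of "?w t"] zt[OF True] z True
        by (simp add: f_def)
      then show ?thesis using True by (simp add: sums_iff)
    qed (simp add: f_def)
  qed
  have int_f: "integral\<^sup>L lborel (f n) =
      of_real (Beta b (c - b)) * (of_real (pochhammer a n * pochhammer b n / (pochhammer c n * fact n)) * z ^ n)" for n
  proof -
    have "f n = (\<lambda>t. (of_real (pochhammer a n / fact n) * z ^ n) *
        of_real (indicator {0..1} t *\<^sub>R (?w t * t ^ n)))"
      by (auto simp: f_def fun_eq_iff scaleR_conv_of_real power_mult_distrib)
    then have "integral\<^sup>L lborel (f n) = (of_real (pochhammer a n / fact n) * z ^ n) *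
        of_real (LINT t:{0..1}|lborel. ?w t * t ^ n)"
      unfolding set_lebesgue_integral_def
      by (simp only: integral_mult_right_zero integral_complex_of_real)
    also have "(LINT t:{0..1}|lborel. ?w t * t ^ n) = Beta b (c - b) * pochhammer b n / pochhammer c n"
      using bc by (simp add: moment_euler_kernel_weight Beta_shift_eq)
    finally show ?thesis by (simp add: mult_ac)
  qed
  have B0: "Beta b (c - b) \<noteq> 0"
    using bc Beta_real_pos[of b "c - b"] by simp
  show ?thesis
    unfolding fps_hypergeo_nth_of_real euler_integral_def
    using sums_divide[OF sums[unfolded int_sum int_f], of "of_real (Beta b (c - b))"] B0
    by (simp only: nonzero_mult_div_cancel_left of_real_eq_0_iff not_False_eq_True)
qed

section \<open>The continued hypergeometric function\<close>

text \<open>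
  The terms of the series were already summed to Euler's integral on the whole unit disc.
\<close>

lemma hypergeo_series_conv_radius:
  assumes "0 < b" "b < c"
  shows "fps_conv_radius (fps_hypergeo [complex_of_real a, of_real b] [of_real c] 1) \<ge> 1"
  unfolding fps_conv_radius_def
proof (rule conv_radius_geI_ex)
  fix r :: real assume "0 < r" "ereal r < 1"
  then show "\<exists>z. norm z = r \<and>
     summable (\<lambda>n. fps_nth (fps_hypergeo [complex_of_real a, of_real b] [of_real c] 1) n * z ^ n)"
    using euler_integral_sums[OF assms, of "of_real r" a]
    by (intro exI[of _ "of_real r"] conjI sums_summable) auto
qed

text \<open>
  The choice operator in \<open>hypergeo_F\<close> picks a genuine continuation, because Euler's integral
  is one.
\<close>

lemma
  assumes "0 < b" "b < c"
  shows holomorphic_hypergeo_F: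
      "hypergeo_F (of_real a) (of_real b) (of_real c) holomorphic_on (- complex_of_real ` {1..})"
    and hypergeo_F_eq_eval_fps: "norm z < 1 \<Longrightarrow>
      hypergeo_F (of_real a) (of_real b) (of_real c) z =
        eval_fps (fps_hypergeo [of_real a, of_real b] [of_real c] 1) z"
proof -
  let ?P = "\<lambda>f. f holomorphic_on (- complex_of_real ` {1..}) \<and>
    (\<forall>z. norm z < 1 \<longrightarrow> f z = eval_fps (fps_hypergeo [of_real a, of_real b] [of_real c] 1) z)"
  have "?P (euler_integral a b c)"
    using holomorphic_euler_integral[OF assms] euler_integral_sums[OF assms]
    by (simp add: eval_fps_def sums_iff)
  then have *: "?P (hypergeo_F (of_real a) (of_real b) (of_real c))"
    unfolding hypergeo_F_def by (rule someI[of ?P])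
  then show "hypergeo_F (of_real a) (of_real b) (of_real c) holomorphic_on (- complex_of_real ` {1..})"
    by blast
  show "hypergeo_F (of_real a) (of_real b) (of_real c) z =
        eval_fps (fps_hypergeo [of_real a, of_real b] [of_real c] 1) z" if "norm z < 1"
    using * that by blast
qed

lemma hypergeo_F_sums:
  assumes "0 < b" "b < c" "norm z < 1"
  shows "(\<lambda>n. of_real (pochhammer a n * pochhammer b n / (pochhammer c n * fact n)) * z ^ n)
           sums hypergeo_F (of_real a) (of_real b) (of_real c) z"
proof -
  have "hypergeo_F (of_real a) (of_real b) (of_real c) z = euler_integral a b c z"
    unfolding hypergeo_F_eq_eval_fps[OF assms] eval_fps_def
    by (rule sums_unique[symmetric, OF euler_integral_sums[OF assms]])
  then show ?thesis
    using euler_integral_sums[OF assms, of a] unfolding fps_hypergeo_nth_of_real by (simp only:)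
qed

lemma ball_subset_slit_plane: "ball 0 1 \<subseteq> - complex_of_real ` {1..}"
proof
  fix z :: complex assume "z \<in> ball 0 1"
  then have "\<bar>Re z\<bar> < 1" using abs_Re_le_cmod[of z] by simp
  then show "z \<in> - complex_of_real ` {1..}" unfolding branch_cut_eq by auto
qed

lemma hypergeo_F_0:
  assumes "0 < b" "b < c"
  shows "hypergeo_F (of_real a) (of_real b) (of_real c) 0 = 1"
  using hypergeo_F_eq_eval_fps[OF assms, of 0 a] by (simp only: eval_fps_at_0 fps_hypergeo_0 norm_zero zero_less_one)

text \<open>
  The coefficients of the series are real, so the symmetry holds in the unit disc, and it extends
  to the slit plane by the identity theorem.
\<close>

lemma hypergeo_F_cnj:
  assumes bc: "0 < b" "b < c" and z: "z \<in> - complex_of_real ` {1..}"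
  shows "hypergeo_F (of_real a) (of_real b) (of_real c) (cnj z) =
         cnj (hypergeo_F (of_real a) (of_real b) (of_real c) z)"
proof -
  let ?S = "- complex_of_real ` {1..}"
  let ?f = "hypergeo_F (of_real a) (of_real b) (of_real c)"
  have S: "cnj ` ?S = ?S"
  proof -
    have "cnj u \<in> ?S" if "u \<in> ?S" for u
      using that by (auto simp: branch_cut_eq)
    then show ?thesis by (force intro: image_eqI[of _ _ "cnj _"])
  qed
  have "(cnj \<circ> ?f \<circ> cnj) z = ?f z"
  proof (rule analytic_continuation_open[of "ball 0 1" ?S "cnj \<circ> ?f \<circ> cnj" ?f])
    show "cnj \<circ> ?f \<circ> cnj holomorphic_on ?S"
      by (rule holomorphic_on_compose_cnj_cnj)
        (use S open_slit_plane holomorphic_hypergeo_F[OF bc] in auto)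
    show "(cnj \<circ> ?f \<circ> cnj) u = ?f u" if "u \<in> ball 0 1" for u
    proof -
      have u: "norm u < 1" using that by simp
      have "(\<lambda>n. cnj (of_real (pochhammer a n * pochhammer b n / (pochhammer c n * fact n)) * cnj u ^ n))
         sums cnj (?f (cnj u))"
        unfolding sums_cnj by (rule hypergeo_F_sums[OF bc]) (simp add: u)
      with hypergeo_F_sums[OF bc u, of a] show ?thesis
        by (simp only: complex_cnj_mult complex_cnj_power complex_cnj_cnj complex_cnj_complex_of_real
            sums_iff comp_apply)
    qed
  qed (use z ball_subset_slit_plane open_slit_plane connected_slit_plane holomorphic_hypergeo_F[OF bc] in auto)
  then have "cnj (?f (cnj z)) = ?f z" by (simp only: comp_apply)
  then show ?thesis by (metis complex_cnj_cnj)
qed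

text \<open>
  The equation is the two-term recurrence
  \<open>(n+1) (c+n) h_(n+1) = (a+n) (b+n) h_n\<close>: its left-hand side collects the terms of weight
  \<open>-1\<close> under \<open>X \<mapsto> t X\<close>, its right-hand side the terms of weight \<open>0\<close>.
\<close>

lemma fps_hypergeo_ode:
  fixes a b c :: complex
  assumes "c \<notin> \<int>\<^sub>\<le>\<^sub>0"
  defines "H \<equiv> fps_hypergeo [a, b] [c] 1"
  shows "fps_X * (1 - fps_X) * fps_deriv (fps_deriv H)
    + (fps_const c - fps_const (a + b + 1) * fps_X) * fps_deriv H - fps_const (a * b) * H = 0"
proof -
  have rec: "of_nat (Suc n) * (c + of_nat n) * fps_nth H (Suc n) = (a + of_nat n) * (b + of_nat n) * fps_nth H n" for n
  proof -
    have "c + of_nat n \<noteq> 0"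
    proof
      assume "c + of_nat n = 0"
      then have "c = - of_nat n" by (simp add: add_eq_0_iff2)
      with assms(1) show False by simp
    qed
    then show ?thesis
      unfolding H_def fps_hypergeo_rec by (simp del: fps_hypergeo_nth of_nat_Suc)
  qed
  have 1: "fps_X * fps_deriv (fps_deriv H) + fps_const c * fps_deriv H =
     Abs_fps (\<lambda>n. of_nat (Suc n) * (c + of_nat n) * fps_nth H (Suc n))" (is "_ = ?R1")
  proof (rule fps_ext)
    fix n show "fps_nth (fps_X * fps_deriv (fps_deriv H) + fps_const c * fps_deriv H) n = fps_nth ?R1 n"
      by (cases n) (auto simp: algebra_simps)
  qed
  have 2: "fps_X * (fps_X * fps_deriv (fps_deriv H)) + fps_const (a + b + 1) * (fps_X * fps_deriv H)
       + fps_const (a * b) * H =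
     Abs_fps (\<lambda>n. (a + of_nat n) * (b + of_nat n) * fps_nth H n)" (is "_ = ?R2")
  proof (rule fps_ext)
    fix n show "fps_nth (fps_X * (fps_X * fps_deriv (fps_deriv H)) + fps_const (a + b + 1) * (fps_X * fps_deriv H)
       + fps_const (a * b) * H) n = fps_nth ?R2 n"
    proof (cases n)
      case (Suc m)
      then show ?thesis by (cases m) (auto simp: algebra_simps)
    qed simp
  qed
  have "?R1 = ?R2" by (simp only: rec)
  then show ?thesis unfolding 1[symmetric] 2[symmetric] by (simp add: algebra_simps)
qed

text \<open>
  True near \<open>0\<close> by the formal identity, hence on the connected slit plane.
\<close>

lemma hypergeo_F_ode:
  fixes a b c :: real and z :: complex
  assumes bc: "0 < b" "b < c" and z: "z \<in> - complex_of_real ` {1..}"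
  defines "f \<equiv> hypergeo_F (of_real a) (of_real b) (of_real c)"
  shows "z * (1 - z) * deriv (deriv f) z + (of_real c - of_real (a + b + 1) * z) * deriv f z
          - of_real (a * b) * f z = 0"
proof -
  let ?S = "- complex_of_real ` {1..}"
  define H where "H = fps_hypergeo [complex_of_real a, of_real b] [of_real c] 1"
  define g where "g = (\<lambda>z. z * (1 - z) * deriv (deriv f) z
     + (of_real c - of_real (a + b + 1) * z) * deriv f z - of_real (a * b) * f z)"
  have hol: "f holomorphic_on ?S" unfolding f_def by (rule holomorphic_hypergeo_F[OF bc])
  have "f has_fps_expansion H"
  proof -
    have "eventually (\<lambda>z. z \<in> ball 0 1) (nhds (0::complex))"
      by (intro eventually_nhds_in_open) auto
    then have "eventually (\<lambda>z. eval_fps H z = f z) (nhds 0)"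
      by eventually_elim (simp add: f_def H_def hypergeo_F_eq_eval_fps[OF bc])
    moreover have "fps_conv_radius H > 0"
      using hypergeo_series_conv_radius[OF bc, of a] unfolding H_def
      by (rule less_le_trans[rotated]) simp
    ultimately show ?thesis by (simp add: has_fps_expansion_def)
  qed
  then have "g has_fps_expansion (fps_X * (1 - fps_X) * fps_deriv (fps_deriv H)
    + (fps_const (of_real c) - fps_const (of_real (a + b + 1)) * fps_X) * fps_deriv H - fps_const (of_real (a * b)) * H)"
    unfolding g_def by (intro fps_expansion_intros has_fps_expansion_deriv)
  also have "fps_X * (1 - fps_X) * fps_deriv (fps_deriv H)
    + (fps_const (of_real c) - fps_const (of_real (a + b + 1)) * fps_X) * fps_deriv H - fps_const (of_real (a * b)) * H = 0"
  proof -
    have "complex_of_real c \<notin> \<int>\<^sub>\<le>\<^sub>0"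
      using bc nonpos_Ints_nonpos[of c] by (auto simp: of_real_in_nonpos_Ints_iff)
    from fps_hypergeo_ode[OF this, of "of_real a" "of_real b"] show ?thesis
      unfolding H_def by simp
  qed
  finally have "eventually (\<lambda>z. g z = 0) (nhds 0)"
    by (auto simp: has_fps_expansion_def elim: eventually_mono)
  then obtain T where T: "open T" "0 \<in> T" "\<And>z. z \<in> T \<Longrightarrow> g z = 0"
    unfolding eventually_nhds by blast
  have "g z = 0"
  proof (rule analytic_continuation_open[of "T \<inter> ?S" ?S g "\<lambda>_. 0"])
    show "g holomorphic_on ?S"
      unfolding g_def by (intro holomorphic_intros hol open_slit_plane)
    have "0 \<in> ?S" by (rule subsetD[OF ball_subset_slit_plane]) simp
    with T(2) show "T \<inter> ?S \<noteq> {}" by (metis IntI empty_iff)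
  qed (use T z open_slit_plane connected_slit_plane in auto)
  then show ?thesis unfolding g_def .
qed

section \<open>The second solution at a logarithmic singularity\<close>

lemma open_slit_ball: "open (ball 0 r - \<real>\<^sub>\<le>\<^sub>0 :: complex set)"
  by (intro open_Diff open_ball closed_nonpos_Reals_complex)

lemma connected_slit_ball:
  assumes "r > 0"
  shows "connected (ball 0 r - \<real>\<^sub>\<le>\<^sub>0 :: complex set)"
proof (rule starlike_imp_connected)
  let ?N = "ball 0 r - \<real>\<^sub>\<le>\<^sub>0 :: complex set" and ?c = "complex_of_real (r / 2)"
  have c: "?c \<in> ?N" using assms by (auto simp: complex_nonpos_Reals_iff)
  have "closed_segment ?c x \<subseteq> ?N" if x: "x \<in> ?N" for x
  proof
    fix y assume y: "y \<in> closed_segment ?c x"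
    have "closed_segment ?c x \<subseteq> ball 0 r"
      using x c by (intro closed_segment_subset) auto
    with y have 1: "y \<in> ball 0 r" by (rule subsetD[rotated])
    obtain u where u: "0 \<le> u" "u \<le> 1" "y = (1 - u) *\<^sub>R ?c + u *\<^sub>R x"
      using y unfolding closed_segment_def by auto
    have "y \<notin> \<real>\<^sub>\<le>\<^sub>0"
    proof
      assume "y \<in> \<real>\<^sub>\<le>\<^sub>0"
      then have y0: "(1 - u) * (r / 2) + u * Re x \<le> 0" "u * Im x = 0"
        using u(3) by (auto simp: complex_nonpos_Reals_iff)
      show False
      proof (cases "u = 0")
        case True
        with y0(1) assms show False by simp
      next
        case False
        with y0(2) x have "Re x > 0" by (auto simp: complex_nonpos_Reals_iff)
        with False u(1) have "u * Re x > 0" by simp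
        moreover have "(1 - u) * (r / 2) \<ge> 0" using u(2) assms by simp
        ultimately show False using y0(1) by linarith
      qed
    qed
    with 1 show "y \<in> ?N" by simp
  qed
  with c show "starlike ?N" unfolding starlike_def by blast
qed

text \<open>
  Reduction of order.  With \<open>s = a + b\<close> and \<open>q = a b\<close> the equation is the hypergeometric one for
  \<open>c = 1\<close>.  Its Wronskian \<open>W\<close> satisfies a first-order linear equation, so that
  \<open>W = C / (z (1 - z)^s)\<close>, and \<open>(\<phi>2/\<phi>1)' = W/\<phi>1^2\<close> has at most a simple pole at \<open>0\<close>, with residue
  \<open>C\<close>.  Integration turns the pole into \<open>C Ln z\<close> and the rest into a holomorphic function.
\<close>

lemma logarithmic_second_solution:
  fixes \<phi>1 \<phi>2 :: "complex \<Rightarrow> complex" and s q :: complex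
  assumes hol1: "\<phi>1 holomorphic_on ball 0 1" and \<phi>10: "\<phi>1 0 = 1"
    and hol2: "\<phi>2 holomorphic_on - \<real>\<^sub>\<le>\<^sub>0"
    and ode1: "\<And>z. z \<in> ball 0 1 \<Longrightarrow>
        z * (1 - z) * deriv (deriv \<phi>1) z + (1 - (s + 1) * z) * deriv \<phi>1 z - q * \<phi>1 z = 0"
    and ode2: "\<And>z. z \<notin> \<real>\<^sub>\<le>\<^sub>0 \<Longrightarrow>
        z * (1 - z) * deriv (deriv \<phi>2) z + (1 - (s + 1) * z) * deriv \<phi>2 z - q * \<phi>2 z = 0"
  obtains r C g where "0 < r" "r \<le> 1" "g holomorphic_on ball 0 r"
    "\<And>z. z \<in> ball 0 r \<Longrightarrow> \<phi>1 z \<noteq> 0"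
    "\<And>z. z \<in> ball 0 r - \<real>\<^sub>\<le>\<^sub>0 \<Longrightarrow> \<phi>2 z = \<phi>1 z * (C * Ln z + g z)"
proof -
  have "open (ball 0 1 \<inter> \<phi>1 -` (- {0}))"
    by (intro continuous_open_preimage holomorphic_on_imp_continuous_on hol1) auto
  then obtain r0 where r0: "r0 > 0" "ball 0 r0 \<subseteq> ball 0 1 \<inter> \<phi>1 -` (- {0})"
    by (rule openE[of _ 0]) (use \<phi>10 in auto)
  define r where "r = min r0 1"
  have r: "0 < r" "r \<le> 1" using r0 by (auto simp: r_def)
  have nz: "\<phi>1 z \<noteq> 0" if "z \<in> ball 0 r" for z
    using r0(2) that by (auto simp: r_def)
  define N :: "complex set" where "N = ball 0 r - \<real>\<^sub>\<le>\<^sub>0"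
  have N: "open N" "connected N"
    unfolding N_def using open_slit_ball connected_slit_ball r by auto
  have NB: "z \<in> ball 0 1" "z \<in> ball 0 r" "z \<notin> \<real>\<^sub>\<le>\<^sub>0" "z \<noteq> 0" "1 - z \<notin> \<real>\<^sub>\<le>\<^sub>0" "1 - z \<noteq> 0" if "z \<in> N" for z
  proof -
    show z: "z \<in> ball 0 1" "z \<in> ball 0 r" "z \<notin> \<real>\<^sub>\<le>\<^sub>0" using that r by (auto simp: N_def)
    show "z \<noteq> 0" using z by auto
    have "Re z < 1" using z(1) abs_Re_le_cmod[of z] by simp
    then show "1 - z \<notin> \<real>\<^sub>\<le>\<^sub>0" "1 - z \<noteq> 0" by (auto simp: complex_nonpos_Reals_iff)
  qed
  have o2: "open (- \<real>\<^sub>\<le>\<^sub>0 :: complex set)" by (intro open_Compl closed_nonpos_Reals_complex)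
  have d1: "(\<phi>1 has_field_derivative deriv \<phi>1 z) (at z)"
           "(deriv \<phi>1 has_field_derivative deriv (deriv \<phi>1) z) (at z)" if "z \<in> ball 0 1" for z
    using that hol1 by (auto intro!: holomorphic_derivI holomorphic_deriv)
  have d2: "(\<phi>2 has_field_derivative deriv \<phi>2 z) (at z)"
           "(deriv \<phi>2 has_field_derivative deriv (deriv \<phi>2) z) (at z)" if "z \<notin> \<real>\<^sub>\<le>\<^sub>0" for z
    using that hol2 o2 by (auto intro!: holomorphic_derivI[of _ "- \<real>\<^sub>\<le>\<^sub>0"] holomorphic_deriv)
  define W where "W = (\<lambda>z. \<phi>1 z * deriv \<phi>2 z - deriv \<phi>1 z * \<phi>2 z)"
  \<comment> \<open>The integrating factor of the equation for \<open>W\<close>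
    is \<open>z (1 - z)^s\<close>, and \<open>E\<close> is its second factor.\<close>
  define E where "E = (\<lambda>z. exp (s * Ln (1 - z)))"
  have dE: "(E has_field_derivative (- s * E z / (1 - z))) (at z)" if "1 - z \<notin> \<real>\<^sub>\<le>\<^sub>0" for z
    unfolding E_def by (rule derivative_eq_intros refl that | simp add: field_simps)+
  have "((\<lambda>z. W z * z * E z) has_field_derivative 0) (at z)" if z: "z \<in> N" for z
  proof -
    note zN = NB[OF z]
    have dW: "(W has_field_derivative (\<phi>1 z * deriv (deriv \<phi>2) z - deriv (deriv \<phi>1) z * \<phi>2 z)) (at z)"
      unfolding W_def
      by (rule derivative_eq_intros d1 d2 zN | simp add: algebra_simps)+
    define W' where "W' = \<phi>1 z * deriv (deriv \<phi>2) z - deriv (deriv \<phi>1) z * \<phi>2 z"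
    have "z * (1 - z) * W' + (1 - (s + 1) * z) * W z =
        \<phi>1 z * (z * (1 - z) * deriv (deriv \<phi>2) z + (1 - (s + 1) * z) * deriv \<phi>2 z - q * \<phi>2 z)
      - \<phi>2 z * (z * (1 - z) * deriv (deriv \<phi>1) z + (1 - (s + 1) * z) * deriv \<phi>1 z - q * \<phi>1 z)"
      by (simp add: W'_def W_def algebra_simps)
    also have "\<dots> = 0" using ode1[OF zN(1)] ode2[OF zN(3)] by simp
    finally have *: "z * (1 - z) * W' + (1 - (s + 1) * z) * W z = 0" .
    have "((\<lambda>z. W z * z * E z) has_field_derivative
        (W' * z + W z) * E z + W z * z * (- s * E z / (1 - z))) (at z)"
      unfolding W'_def
      by (rule derivative_eq_intros dW dE zN refl | simp add: algebra_simps)+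
    also have "(W' * z + W z) * E z + W z * z * (- s * E z / (1 - z)) =
        E z / (1 - z) * (z * (1 - z) * W' + (1 - (s + 1) * z) * W z)"
      using zN(6) by (simp add: divide_simps) (simp add: algebra_simps)
    finally show ?thesis using * by simp
  qed
  from has_field_derivative_0_imp_constant_on[OF this N(2,1)] obtain C where
    C: "\<And>z. z \<in> N \<Longrightarrow> W z * z * E z = C"
    unfolding constant_on_def by blast
  define \<kappa> where "\<kappa> = (\<lambda>z. C / (E z * (\<phi>1 z)\<^sup>2))"
  have hol1r: "\<phi>1 holomorphic_on ball 0 r"
    using hol1 r by (auto intro: holomorphic_on_subset)
  have nonpos: "1 - z \<notin> \<real>\<^sub>\<le>\<^sub>0" if "z \<in> ball 0 r" for z :: complex
    using that r abs_Re_le_cmod[of z] by (auto simp: complex_nonpos_Reals_iff)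
  have hol\<kappa>: "\<kappa> holomorphic_on ball 0 r"
    unfolding \<kappa>_def E_def
    by (intro holomorphic_intros hol1r) (use nz nonpos in auto)
  have \<kappa>0: "\<kappa> 0 = C" by (simp add: \<kappa>_def E_def \<phi>10)
  \<comment> \<open>Here \<open>\<kappa> z / z\<close> is the derivative of
    \<open>\<phi>2 / \<phi>1\<close>, and \<open>k\<close> is what remains of it after removal of the polar part \<open>C / z\<close>.\<close>
  define k where "k = (\<lambda>z. if z = 0 then deriv \<kappa> 0 else (\<kappa> z - \<kappa> 0) / (z - 0))"
  have "k holomorphic_on ball 0 r"
    unfolding k_def by (rule pole_lemma[OF hol\<kappa>]) (use r in simp)
  from holomorphic_convex_primitive'[OF convex_ball open_ball this] obtain g0 where
    g0: "\<And>x. x \<in> ball 0 r \<Longrightarrow> (g0 has_field_derivative k x) (at x within ball 0 r)" by blast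
  have g0': "(g0 has_field_derivative k x) (at x)" if "x \<in> ball 0 r" for x
    using g0[OF that] by (simp only: at_within_open[OF that open_ball])
  have "((\<lambda>z. \<phi>2 z / \<phi>1 z - C * Ln z - g0 z) has_field_derivative 0) (at z)" if z: "z \<in> N" for z
  proof -
    note zN = NB[OF z]
    have E0: "E z \<noteq> 0" by (simp add: E_def)
    have "((\<lambda>z. \<phi>2 z / \<phi>1 z - C * Ln z - g0 z) has_field_derivative
        (W z / (\<phi>1 z)\<^sup>2 - C / z - k z)) (at z)"
      unfolding W_def
      by (rule derivative_eq_intros d1 d2 g0' zN nz refl
          | simp add: field_simps power2_eq_square zN(4))+
    also have "W z = C / (z * E z)" using C[OF z] zN(4) E0 by (simp add: field_simps)
    also have "C / (z * E z) / (\<phi>1 z)\<^sup>2 - C / z - k z = 0"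
      using zN(4) \<kappa>0 by (simp add: k_def \<kappa>_def field_simps)
    finally show ?thesis .
  qed
  from has_field_derivative_0_imp_constant_on[OF this N(2,1)] obtain c0 where
    c0: "\<And>z. z \<in> N \<Longrightarrow> \<phi>2 z / \<phi>1 z - C * Ln z - g0 z = c0"
    unfolding constant_on_def by blast
  show thesis
  proof (rule that[OF r, of "\<lambda>z. g0 z + c0" C])
    have "g0 holomorphic_on ball 0 r"
      unfolding holomorphic_on_def field_differentiable_def using g0 by blast
    then show "(\<lambda>z. g0 z + c0) holomorphic_on ball 0 r" by (intro holomorphic_intros)
    show "\<phi>2 z = \<phi>1 z * (C * Ln z + (g0 z + c0))" if "z \<in> ball 0 r - \<real>\<^sub>\<le>\<^sub>0" for z
      using c0[of z] nz[of z] that by (simp add: N_def field_simps)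
  qed (rule nz)
qed

section \<open>The two constants of the logarithmic expansion\<close>

lemma pos_not_nonpos_Ints: "0 < (x::real) \<Longrightarrow> x \<notin> \<int>\<^sub>\<le>\<^sub>0"
  using nonpos_Ints_nonpos[of x] by auto

lemma Gamma_plus1_real: "0 < x \<Longrightarrow> Gamma (x + 1) = x * Gamma (x::real)"
  by (rule Gamma_plus1[OF pos_not_nonpos_Ints])

text \<open>
  \<open>B(a,b)\<close> times the \<open>n\<close>-th coefficient of \<open>F(a,b;a+b;z)\<close>.  Written with Gamma functions it can be
  compared for different values of \<open>a\<close> with the same \<open>n\<close>, and it is asymptotic to \<open>1/n\<close>.
\<close>

definition gamma_quotient :: "real \<Rightarrow> real \<Rightarrow> nat \<Rightarrow> real" where
  "gamma_quotient a b n =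
     Gamma (a + real n) * Gamma (b + real n) / (Gamma (a + b + real n) * fact n)"

lemma gamma_quotient_eq_pochhammer:
  assumes "0 < a" "0 < b"
  shows "gamma_quotient a b n =
      Beta a b * (pochhammer a n * pochhammer b n / (pochhammer (a + b) n * fact n))"
proof -
  have G: "Gamma (x + real n) = Gamma x * pochhammer x n" if "x > 0" for x
    using pochhammer_Gamma[OF pos_not_nonpos_Ints[OF that], of n] Gamma_real_pos[OF that] by (simp add: field_simps)
  show ?thesis
    using assms by (simp add: gamma_quotient_def Beta_def G mult_ac)
qed

lemma gamma_quotient_plus1_left:
  assumes "0 < a" "0 < b"
  shows "(a + b + real n) * gamma_quotient (a + 1) b n = (a + real n) * gamma_quotient a b n"
proof -
  have "Gamma (a + 1 + real n) = (a + real n) * Gamma (a + real n)"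
       "Gamma (a + 1 + b + real n) = (a + b + real n) * Gamma (a + b + real n)"
    using assms Gamma_plus1_real[of "a + real n"] Gamma_plus1_real[of "a + b + real n"] by (simp_all add: add_ac)
  then show ?thesis
    using assms by (simp add: gamma_quotient_def)
qed

lemma gamma_quotient_Suc:
  assumes "0 < a" "0 < b"
  shows "(a + b + real n) * (real (Suc n) * gamma_quotient a b (Suc n))
           = (a + real n) * (b + real n) * gamma_quotient a b n"
proof -
  have G: "Gamma (x + real (Suc n)) = (x + real n) * Gamma (x + real n)" if "x > 0" for x :: real
    using that Gamma_plus1_real[of "x + real n"] by (simp add: add_ac)
  show ?thesis
    using assms unfolding gamma_quotient_def G[OF assms(1)] G[OF assms(2)] G[OF add_pos_pos[OF assms]] fact_Suc
    by (simp add: divide_simps del: of_nat_Suc) 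
qed

text \<open>
  As a function of \<open>a\<close> the quotient is a positive multiple of \<open>B(a+n, b)\<close>.
\<close>

lemma gamma_quotient_antimono:
  assumes "0 < x" "x \<le> y" "0 < b"
  shows "gamma_quotient y b n \<le> gamma_quotient x b n"
proof -
  have eq: "gamma_quotient z b n = Beta (z + real n) b * (Gamma (b + real n) / (Gamma b * fact n))"
    for z
  proof -
    have "Gamma b \<noteq> 0" using Gamma_real_pos[OF assms(3)] by (metis less_irrefl)
    then show ?thesis by (simp add: gamma_quotient_def Beta_def add_ac)
  qed
  have "Beta (y + real n) b \<le> Beta (x + real n) b"
    using assms by (intro Beta_real_mono) auto
  then show ?thesis
    using assms by (simp only: eq) (intro mult_right_mono, auto simp: Gamma_real_pos less_imp_le)
qed

text \<open>
  In Euler's product formula for Gamma the powers of \<open>n\<close> cancel, because the parameters \<open>a\<close> and \<open>b\<close>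
  above balance the parameter \<open>a + b\<close> below.
\<close>

lemma gamma_quotient_mult_index_tendsto:
  assumes "0 < a" "0 < b"
  shows "(\<lambda>n. real n * gamma_quotient a b n) \<longlonglongrightarrow> 1"
proof -
  have pos: "Gamma a > 0" "Gamma b > 0" "Gamma (a + b) > 0" using assms by (auto simp: Gamma_real_pos)
  have "(\<lambda>n. Beta a b * (Gamma_series' (a + b) n / (Gamma_series' a n * Gamma_series' b n)))
          \<longlonglongrightarrow> Beta a b * (Gamma (a + b) / (Gamma a * Gamma b))"
    using pos by (intro tendsto_intros Gamma_series'_LIMSEQ) auto
  also have "Beta a b * (Gamma (a + b) / (Gamma a * Gamma b)) = 1"
    using pos by (simp add: Beta_def)
  finally have lim: "(\<lambda>n. Beta a b * (Gamma_series' (a + b) n / (Gamma_series' a n * Gamma_series' b n)))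
          \<longlonglongrightarrow> 1" .
  show ?thesis
  proof (rule Lim_transform_eventually[OF lim])
    show "\<forall>\<^sub>F n in sequentially. Beta a b * (Gamma_series' (a + b) n / (Gamma_series' a n * Gamma_series' b n))
        = real n * gamma_quotient a b n"
      using eventually_gt_at_top[of 0]
    proof eventually_elim
      case (elim n)
      have f: "(fact n :: real) = real n * fact (n - 1)"
        using elim by (simp add: fact_reduce)
      have e: "exp ((a + b) * ln (real n)) = exp (a * ln (real n)) * exp (b * ln (real n))"
        by (simp add: exp_add[symmetric] algebra_simps)
      have p: "pochhammer a n > 0" "pochhammer b n > 0" "pochhammer (a + b) n > 0"
        using assms by (auto intro: pochhammer_pos)
      then show ?case
        using elim unfolding gamma_quotient_eq_pochhammer[OF assms] Gamma_series'_def f of_real_eq_id id_apply e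
        by (simp add: divide_simps)
    qed
  qed
qed

text \<open>
  A telescoping sum: with \<open>U_n = n T_n(a)\<close>, where \<open>T_n(a)\<close> is the quotient, one has
  \<open>T_n(a) - T_n(a+1) = (U_(n+1) - U_n) / a\<close>, and \<open>U\<close> runs from \<open>0\<close> to \<open>1\<close>.
\<close>

lemma gamma_quotient_diff_sums:
  assumes "0 < a" "0 < b"
  shows "(\<lambda>n. gamma_quotient a b n - gamma_quotient (a + 1) b n) sums (1 / a)"
proof -
  have "(\<lambda>n. real (Suc n) * gamma_quotient a b (Suc n) - real n * gamma_quotient a b n)
      sums (1 - real 0 * gamma_quotient a b 0)"
    by (rule telescope_sums[OF gamma_quotient_mult_index_tendsto[OF assms]])
  from sums_divide[OF this, of a]
  have "(\<lambda>n. (real (Suc n) * gamma_quotient a b (Suc n) - real n * gamma_quotient a b n) / a) sums (1 / a)"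
    by simp
  also have "(\<lambda>n. (real (Suc n) * gamma_quotient a b (Suc n) - real n * gamma_quotient a b n) / a)
      = (\<lambda>n. gamma_quotient a b n - gamma_quotient (a + 1) b n)"
  proof
    fix n
    let ?T = "gamma_quotient a b n"
    have s: "a + b + real n > 0" using assms by simp
    have 1: "gamma_quotient (a + 1) b n = (a + real n) * ?T / (a + b + real n)"
      using gamma_quotient_plus1_left[OF assms, of n] s by (simp add: field_simps)
    have 2: "real (Suc n) * gamma_quotient a b (Suc n) = (a + real n) * (b + real n) * ?T / (a + b + real n)"
      using gamma_quotient_Suc[OF assms, of n] s by (simp add: field_simps)
    show "(real (Suc n) * gamma_quotient a b (Suc n) - real n * ?T) / a = ?T - gamma_quotient (a + 1) b n"
      unfolding 1 2 using s assms by (simp add: divide_simps) (simp add: algebra_simps)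
  qed
  finally show ?thesis .
qed

lemma gamma_quotient_one:
  assumes "0 < b"
  shows "gamma_quotient 1 b n = 1 / (b + real n)"
proof -
  have "Gamma (1 + b + real n) = (b + real n) * Gamma (b + real n)"
    using assms Gamma_plus1_real[of "b + real n"] by (simp add: add_ac)
  moreover have "Gamma (1 + real n) = fact n" by (simp add: Gamma_fact)
  moreover have "Gamma (b + real n) > 0" using assms by (simp add: Gamma_real_pos)
  ultimately show ?thesis by (simp add: gamma_quotient_def)
qed

lemma Digamma_diff_sums:
  assumes "0 < (x::real)"
  shows "(\<lambda>n. 1 / (x + real n) - 1 / (real n + 1)) sums (Digamma 1 - Digamma x)"
proof -
  have "(\<lambda>k. inverse (of_nat (Suc k)) - inverse (x + of_nat k)) sums (Digamma x + euler_mascheroni)"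
    unfolding Digamma_def[of x] using summable_sums[OF summable_Digamma[of x]] assms by simp
  from sums_minus[OF this] show ?thesis by (simp add: inverse_eq_divide add_ac)
qed

text \<open>
  By the telescoping sum, replacing the pair \<open>(a, 1)\<close> by \<open>(a+1, 2)\<close> changes the sum by the next term
  of the series of the digamma function.  After \<open>N\<close> such shifts the remaining sum is squeezed
  between \<open>0\<close> and \<open>1/(a+N)\<close>, by monotonicity in \<open>a\<close> and \<open>a + N \<le> 1 + N \<le> a + N + 1\<close>.
\<close>

lemma gamma_quotient_minus_one_sums:
  assumes a: "0 < a" "a \<le> 1" and b: "0 < b"
  shows "(\<lambda>n. gamma_quotient a b n - gamma_quotient 1 b n) sums (Digamma 1 - Digamma a)"
proof -
  define f where "f = (\<lambda>N n. gamma_quotient (a + real N) b n - gamma_quotient (1 + real N) b n)"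
  have f0: "f N n \<ge> 0" for N n
    unfolding f_def using a b gamma_quotient_antimono[of "a + real N" "1 + real N" b n] by simp
  have fle: "f N n \<le> gamma_quotient (a + real N) b n - gamma_quotient (a + real N + 1) b n" for N n
    unfolding f_def using a b gamma_quotient_antimono[of "1 + real N" "a + real N + 1" b n] by simp
  have ds: "(\<lambda>n. gamma_quotient (a + real N) b n - gamma_quotient (a + real N + 1) b n) sums (1 / (a + real N))" for N
    using a b by (intro gamma_quotient_diff_sums) auto
  have sf: "summable (f N)" for N
    by (rule summable_comparison_test'[OF sums_summable[OF ds[of N]], of 0]) (use f0 fle in auto)
  define S where "S = (\<lambda>N. suminf (f N))"
  have Sf: "f N sums S N" for N unfolding S_def using sf by (rule summable_sums)
  have S0: "0 \<le> S N" for N unfolding S_def by (intro suminf_nonneg sf f0)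
  have Sle: "S N \<le> 1 / (a + real N)" for N
    by (rule sums_le[OF fle Sf ds])
  have Slim: "S \<longlonglongrightarrow> 0"
  proof (rule tendsto_sandwich[OF _ _ tendsto_const])
    show "(\<lambda>N. 1 / (a + real N)) \<longlonglongrightarrow> 0" by real_asymp
  qed (use S0 Sle in auto)
  have "S N - S (Suc N) = 1 / (a + real N) - 1 / (real N + 1)" for N
  proof -
    have "(\<lambda>n. f N n - f (Suc N) n) sums (S N - S (Suc N))" by (intro sums_diff Sf)
    moreover have "(\<lambda>n. f N n - f (Suc N) n) =
      (\<lambda>n. (gamma_quotient (a + real N) b n - gamma_quotient (a + real N + 1) b n) -
           (gamma_quotient (1 + real N) b n - gamma_quotient (1 + real N + 1) b n))"
      by (simp add: f_def algebra_simps)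
    moreover have "\<dots> sums (1 / (a + real N) - 1 / (1 + real N))"
      using a b by (intro sums_diff gamma_quotient_diff_sums) auto
    ultimately show ?thesis using sums_unique2 by (metis add.commute)
  qed
  with telescope_sums'[OF Slim] have "(\<lambda>N. 1 / (a + real N) - 1 / (real N + 1)) sums S 0" by simp
  with Digamma_diff_sums[OF a(1)] have "S 0 = Digamma 1 - Digamma a" by (rule sums_unique2[symmetric])
  with Sf[of 0] show ?thesis by (simp add: f_def)
qed

text \<open>
  The absolutely convergent case of Abel's theorem, in the variable \<open>x\<close> with the point \<open>1 - x\<close>
  approaching \<open>1\<close> from below.
\<close>

lemma power_series_tendsto_sum_at_left:
  fixes e :: "nat \<Rightarrow> real"
  assumes "summable (\<lambda>n. \<bar>e n\<bar>)"
  shows "((\<lambda>x. \<Sum>n. e n * (1 - x) ^ n) \<longlongrightarrow> (\<Sum>n. e n)) (at_right 0)"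
proof -
  have "uniform_limit {0..1} (\<lambda>N x. \<Sum>n<N. e n * (1 - x) ^ n) (\<lambda>x. \<Sum>n. e n * (1 - x) ^ n) sequentially"
  proof (rule Weierstrass_m_test[OF _ assms])
    fix n and x :: real assume "x \<in> {0..1}"
    then have "(1 - x) ^ n \<le> 1" by (intro power_le_one) auto
    with \<open>x \<in> {0..1}\<close> show "norm (e n * (1 - x) ^ n) \<le> \<bar>e n\<bar>"
      by (simp add: abs_mult mult_left_le)
  qed
  then have "continuous_on {0..1} (\<lambda>x. \<Sum>n. e n * (1 - x) ^ n)"
    by (rule uniform_limit_theorem[rotated]) (auto intro!: always_eventually continuous_intros)
  then have "((\<lambda>x. \<Sum>n. e n * (1 - x) ^ n) \<longlongrightarrow> (\<Sum>n. e n * (1 - 0) ^ n)) (at 0 within {0..1})"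
    unfolding continuous_on_def by (rule bspec) simp
  then show ?thesis by (simp add: at_within_Icc_at_right)
qed

lemma harmonic_series_sums:
  assumes "0 < x" "x < (1::real)"
  shows "(\<lambda>n. (1 - x) ^ n / (real n + 1)) sums (- ln x / (1 - x))"
proof -
  have "(\<lambda>n. - ((- (- (1 - x))) ^ n) / of_nat n) sums ln (1 + (- (1 - x)))"
    using assms by (intro ln_series') auto
  then have "(\<lambda>n. (1 - x) ^ n / real n) sums (- ln x)"
    using sums_minus by fastforce
  then have "(\<lambda>n. (1 - x) ^ Suc n / real (Suc n)) sums (- ln x)"
    by (subst sums_Suc_iff) simp
  from sums_divide[OF this, of "1 - x"] show ?thesis
    using assms by (simp add: add_ac)
qed

text \<open>
  Compare the coefficients \<open>T_n\<close> of \<open>B(a,b) F\<close> with those of \<open>-ln x / (1 - x)\<close>, which are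
  \<open>1/(n+1)\<close>.  The difference splits into \<open>T_n(a) - T_n(1)\<close> and
  \<open>T_n(1) - 1/(n+1) = 1/(b+n) - 1/(n+1)\<close>; both are nonnegative because of \<open>a, b \<le> 1\<close>, and
  their sums are digamma differences.
\<close>

lemma log_asymptotics_at_one:
  fixes a b :: real and F :: "real \<Rightarrow> real"
  assumes a: "0 < a" "a \<le> 1" and b: "0 < b" "b \<le> 1"
    and F: "\<And>x. 0 < x \<Longrightarrow> x < 1 \<Longrightarrow>
      (\<lambda>n. pochhammer a n * pochhammer b n / (pochhammer (a + b) n * fact n) * (1 - x) ^ n) sums F x"
  shows "((\<lambda>x. Beta a b * F x + ln x) \<longlongrightarrow> 2 * Digamma 1 - Digamma a - Digamma b) (at_right 0)"
proof -
  define e1 where "e1 = (\<lambda>n. gamma_quotient a b n - gamma_quotient 1 b n)"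
  define e2 where "e2 = (\<lambda>n. gamma_quotient 1 b n - 1 / (real n + 1))"
  have s1: "e1 sums (Digamma 1 - Digamma a)"
    unfolding e1_def using a b by (intro gamma_quotient_minus_one_sums)
  have s2: "e2 sums (Digamma 1 - Digamma b)"
    unfolding e2_def gamma_quotient_one[OF b(1)] using b by (intro Digamma_diff_sums)
  have p1: "e1 n \<ge> 0" for n
    unfolding e1_def using gamma_quotient_antimono[of a 1 b n] a b by simp
  have p2: "e2 n \<ge> 0" for n
    unfolding e2_def gamma_quotient_one[OF b(1)] using b by (simp add: field_simps)
  define e where "e = (\<lambda>n. e1 n + e2 n)"
  have se: "e sums (2 * Digamma 1 - Digamma a - Digamma b)"
    unfolding e_def using sums_add[OF s1 s2] by (simp add: algebra_simps)
  have "summable (\<lambda>n. \<bar>e n\<bar>)"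
    using sums_summable[OF se] p1 p2 by (simp add: e_def)
  from power_series_tendsto_sum_at_left[OF this]
  have lim: "((\<lambda>x. \<Sum>n. e n * (1 - x) ^ n) \<longlongrightarrow> 2 * Digamma 1 - Digamma a - Digamma b) (at_right 0)"
    using se by (simp add: sums_iff)
  have eq: "Beta a b * F x + ln x / (1 - x) = (\<Sum>n. e n * (1 - x) ^ n)" if x: "0 < x" "x < 1" for x
  proof -
    have "(\<lambda>n. gamma_quotient a b n * (1 - x) ^ n) sums (Beta a b * F x)"
      using sums_mult[OF F[OF x], of "Beta a b"]
      by (simp add: gamma_quotient_eq_pochhammer[OF a(1) b(1)] mult_ac)
    from sums_diff[OF this harmonic_series_sums[OF x]]
    have "(\<lambda>n. e n * (1 - x) ^ n) sums (Beta a b * F x - (- ln x / (1 - x)))"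
      by (simp add: e_def e1_def e2_def algebra_simps)
    then show ?thesis by (simp add: sums_iff)
  qed
  have "((\<lambda>x::real. ln x - ln x / (1 - x)) \<longlongrightarrow> 0) (at_right 0)" by real_asymp
  from tendsto_add[OF lim this]
  have "((\<lambda>x. (\<Sum>n. e n * (1 - x) ^ n) + (ln x - ln x / (1 - x))) \<longlongrightarrow>
      2 * Digamma 1 - Digamma a - Digamma b) (at_right 0)" by simp
  then show ?thesis
  proof (rule Lim_transform_eventually)
    have "\<forall>\<^sub>F x in at_right (0::real). x \<in> {0<..<1}" by (rule eventually_at_right_real) simp
    then show "\<forall>\<^sub>F x in at_right 0. (\<Sum>n. e n * (1 - x) ^ n) + (ln x - ln x / (1 - x)) = Beta a b * F x + ln x"
      by eventually_elim (simp add: eq[symmetric])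
  qed
qed

text \<open>
  The logarithmic derivative of \<open>\<Gamma>(y) \<Gamma>(1-y) sin (\<pi> y) = \<pi>\<close>.
\<close>

lemma Digamma_reflection_real:
  assumes x: "0 < x" "x < (1::real)"
  shows "Digamma (1 - x) - Digamma x = pi * cos (pi * x) / sin (pi * x)"
proof -
  have refl: "Gamma y * Gamma (1 - y) * sin (pi * y) = pi" if "y \<in> {0<..<1}" for y :: real
  proof -
    have s: "sin (pi * y) > 0" using that by (intro sin_gt_zero) auto
    have 1: "1 - complex_of_real y = of_real (1 - y)"
      and 2: "complex_of_real pi * of_real y = of_real (pi * y)" by simp_all
    have "complex_of_real (Gamma y * Gamma (1 - y)) = of_real (pi / sin (pi * y))"
      using Gamma_reflection_complex[of "of_real y"]
      unfolding 1 2 Gamma_complex_of_real sin_of_real by (simp only: of_real_mult of_real_divide)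
    then have "Gamma y * Gamma (1 - y) = pi / sin (pi * y)" by (simp only: of_real_eq_iff)
    then show ?thesis using s by simp
  qed
  have "((\<lambda>y. Gamma y * Gamma (1 - y) * sin (pi * y)) has_real_derivative
     Gamma x * Gamma (1 - x) * ((Digamma x - Digamma (1 - x)) * sin (pi * x) + pi * cos (pi * x))) (at x)"
    using pos_not_nonpos_Ints[of x] pos_not_nonpos_Ints[of "1 - x"] x
    by (auto intro!: derivative_eq_intros simp: algebra_simps)
  moreover have "((\<lambda>y. Gamma y * Gamma (1 - y) * sin (pi * y)) has_real_derivative 0) (at x)"
  proof (rule has_field_derivative_transform_within_open[of "\<lambda>_. pi" 0 x "{0<..<1}"])
    show "((\<lambda>_. pi) has_real_derivative 0) (at x)" by simp
  qed (use x refl in auto)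
  ultimately have "Gamma x * Gamma (1 - x) * ((Digamma x - Digamma (1 - x)) * sin (pi * x) + pi * cos (pi * x)) = 0"
    by (rule DERIV_unique)
  moreover have "Gamma x > 0" "Gamma (1 - x) > 0" using x by (auto simp: Gamma_real_pos)
  ultimately have "(Digamma x - Digamma (1 - x)) * sin (pi * x) + pi * cos (pi * x) = 0" by simp
  moreover have "sin (pi * x) > 0" using x by (intro sin_gt_zero) auto
  ultimately show ?thesis by (simp add: field_simps)
qed

section \<open>Wirtinger calculus near a logarithmic puncture\<close>

text \<open>
  The Frechet derivative as \<open>A dz + B d(cnj z)\<close>.  In contrast to the partial derivatives in
  \<open>wirtinger\<close> and \<open>wirtinger_bar\<close> this notion comes with rules for
  sums, products and inverses.
\<close>

definition has_wirtinger :: "(complex \<Rightarrow> complex) \<Rightarrow> complex \<Rightarrow> complex \<Rightarrow> complex \<Rightarrow> bool" where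
  "has_wirtinger f A B z \<longleftrightarrow> (f has_derivative (\<lambda>h. A * h + B * cnj h)) (at z)"

lemma wirtinger_eqI:
  assumes f: "has_wirtinger f A B z"
  shows "wirtinger f z = A" "wirtinger_bar f z = B"
proof -
  have *: "vector_derivative (\<lambda>t. f (z + u * of_real t)) (at 0) = A * u + B * cnj u" for u
  proof (rule vector_derivative_at)
    have "((\<lambda>t. z + u * complex_of_real t) has_derivative (\<lambda>t. u * of_real t)) (at 0)"
      by (auto intro!: derivative_eq_intros)
    moreover have "(f has_derivative (\<lambda>h. A * h + B * cnj h)) (at (z + u * complex_of_real 0))"
      using f by (simp add: has_wirtinger_def)
    ultimately have "((\<lambda>t. f (z + u * complex_of_real t)) has_derivative
        (\<lambda>t. A * (u * of_real t) + B * cnj (u * of_real t))) (at 0)"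
      by (rule has_derivative_compose)
    then show "((\<lambda>t. f (z + u * complex_of_real t)) has_vector_derivative A * u + B * cnj u) (at 0)"
      by (simp add: has_vector_derivative_def scaleR_conv_of_real algebra_simps)
  qed
  have px: "partial_x f z = A + B" and py: "partial_y f z = \<i> * (A - B)"
    using *[of 1] *[of \<i>] by (simp_all add: partial_x_def partial_y_def algebra_simps)
  show "wirtinger f z = A" "wirtinger_bar f z = B"
    by (simp_all add: wirtinger_def wirtinger_bar_def px py algebra_simps)
qed

text \<open>
  Differentiability of an explicit expression carries over to a function that agrees with it on
  an open set.  In this way the iterated Wirtinger derivatives need to be known on a
  punctured disc only.
\<close>

lemma has_wirtinger_transform:
  assumes "has_wirtinger f A B z" "open S" "z \<in> S" "\<And>u. u \<in> S \<Longrightarrow> f u = g u"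
  shows "has_wirtinger g A B z"
  unfolding has_wirtinger_def
  by (rule has_derivative_transform_within_open[OF assms(1)[unfolded has_wirtinger_def] assms(2-4)])

lemma has_wirtinger_add:
  "has_wirtinger f A B z \<Longrightarrow> has_wirtinger g A' B' z \<Longrightarrow>
     has_wirtinger (\<lambda>z. f z + g z) (A + A') (B + B') z"
  unfolding has_wirtinger_def by (drule (1) has_derivative_add) (simp add: algebra_simps)

lemma has_wirtinger_mult:
  "has_wirtinger f A B z \<Longrightarrow> has_wirtinger g A' B' z \<Longrightarrow>
     has_wirtinger (\<lambda>z. f z * g z) (A * g z + f z * A') (B * g z + f z * B') z"
  unfolding has_wirtinger_def by (drule (1) has_derivative_mult) (simp add: algebra_simps)

lemma has_wirtinger_inverse:
  assumes "has_wirtinger f A B z" "f z \<noteq> 0"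
  shows "has_wirtinger (\<lambda>z. inverse (f z)) (- A * (inverse (f z))\<^sup>2) (- B * (inverse (f z))\<^sup>2) z"
  using Deriv.has_derivative_inverse[OF assms(2) assms(1)[unfolded has_wirtinger_def]]
  unfolding has_wirtinger_def by (simp add: algebra_simps power2_eq_square)

lemma has_wirtinger_holomorphic:
  "(f has_field_derivative A) (at z) \<Longrightarrow> has_wirtinger f A 0 z"
  by (simp add: has_wirtinger_def has_field_derivative_def)

lemma has_wirtinger_cnj:
  assumes "has_wirtinger f A B z"
  shows "has_wirtinger (\<lambda>z. cnj (f z)) (cnj B) (cnj A) z"
  using has_derivative_cnj[OF assms[unfolded has_wirtinger_def]]
  by (simp add: has_wirtinger_def add.commute)

lemma has_wirtinger_const: "has_wirtinger (\<lambda>_. c) 0 0 z"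
  by (simp add: has_wirtinger_def)

lemma has_wirtinger_ln_norm:
  assumes "z \<noteq> 0"
  shows "has_wirtinger (\<lambda>z. of_real (ln (norm z))) (1 / (2 * z)) (1 / (2 * cnj z)) z"
proof -
  have "((\<lambda>z. complex_of_real (ln (norm z))) has_derivative
      (\<lambda>h. of_real (inner (sgn z) h * inverse (norm z)))) (at z)"
    using assms by (auto intro!: derivative_eq_intros has_derivative_norm simp: divide_inverse mult_ac inner_commute)
  also have "(\<lambda>h. complex_of_real (inner (sgn z) h * inverse (norm z))) =
     (\<lambda>h. 1 / (2 * z) * h + 1 / (2 * cnj z) * cnj h)"
  proof
    fix h
    have n2: "complex_of_real ((norm z)\<^sup>2) = z * cnj z"
      by (rule complex_norm_square)
    have "inner (sgn z) h * inverse (norm z) = Re (cnj z * h) / (norm z)\<^sup>2"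
      by (simp add: sgn_div_norm inner_complex_def power2_eq_square divide_inverse algebra_simps)
    have "complex_of_real (inner (sgn z) h * inverse (norm z)) = (cnj z * h + z * cnj h) / 2 / (z * cnj z)"
    proof -
      have "complex_of_real (Re (cnj z * h)) = (cnj z * h + z * cnj h) / 2"
        by (simp add: complex_eq_iff)
      then show ?thesis
        unfolding n2[symmetric] \<open>inner (sgn z) h * inverse (norm z) = _\<close> of_real_divide by (simp only:)
    qed
    also have "\<dots> = 1 / (2 * z) * h + 1 / (2 * cnj z) * cnj h"
      using assms by (simp add: field_simps)
    finally show "complex_of_real (inner (sgn z) h * inverse (norm z)) =
       1 / (2 * z) * h + 1 / (2 * cnj z) * cnj h" .
  qed
  finally show ?thesis unfolding has_wirtinger_def .
qed

text \<open>
  The logarithm is taken on the real line, so \<open>A h + B cnj h\<close> must first be recognised as a real number: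
  it is a derivative of a real-valued function.
\<close>

lemma has_wirtinger_of_real_ln:
  assumes "has_wirtinger (\<lambda>z. of_real (f z)) A B z" "f z > 0"
  shows "has_wirtinger (\<lambda>z. of_real (ln (f z))) (A / of_real (f z)) (B / of_real (f z)) z"
proof -
  have "(f has_derivative (\<lambda>h. Re (A * h + B * cnj h))) (at z)"
    using has_derivative_Re[OF assms(1)[unfolded has_wirtinger_def]] by simp
  then have der: "((\<lambda>z. complex_of_real (ln (f z))) has_derivative
     (\<lambda>h. of_real (Re (A * h + B * cnj h) * inverse (f z)))) (at z)"
    using assms(2) by (auto intro!: derivative_eq_intros simp: divide_inverse)
  have "complex_of_real (Re (A * h + B * cnj h)) = A * h + B * cnj h" for h
  proof -
    have "(\<lambda>h. Im (A * h + B * cnj h)) = (\<lambda>h. 0)"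
      using has_derivative_Im[OF assms(1)[unfolded has_wirtinger_def]]
      by (intro has_derivative_unique[of "\<lambda>_. 0"]) auto
    then show ?thesis by (simp add: complex_eq_iff fun_eq_iff)
  qed
  then have "(\<lambda>h. complex_of_real (Re (A * h + B * cnj h) * inverse (f z))) =
      (\<lambda>h. A / of_real (f z) * h + B / of_real (f z) * cnj h)"
    by (simp only: of_real_mult of_real_inverse divide_inverse) (simp add: algebra_simps)
  with der show ?thesis
    unfolding has_wirtinger_def by (simp only:)
qed

text \<open>
  The coefficients of the expansions: a class of functions that contains \<open>Q\<close>, its conjugate and the
  derivatives of both, is closed under the Wirtinger derivatives, and consists of functions
  differentiable at the origin.
\<close>

inductive_set mixed_algebra :: "real \<Rightarrow> (complex \<Rightarrow> complex) set" for r :: real where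
  hol: "h holomorphic_on ball 0 r \<Longrightarrow> h \<in> mixed_algebra r"
| cnj: "h holomorphic_on ball 0 r \<Longrightarrow> (\<lambda>z. cnj (h z)) \<in> mixed_algebra r"
| add: "e \<in> mixed_algebra r \<Longrightarrow> e' \<in> mixed_algebra r \<Longrightarrow> (\<lambda>z. e z + e' z) \<in> mixed_algebra r"
| mult: "e \<in> mixed_algebra r \<Longrightarrow> e' \<in> mixed_algebra r \<Longrightarrow> (\<lambda>z. e z * e' z) \<in> mixed_algebra r"

lemma mixed_algebra_const: "(\<lambda>_. c) \<in> mixed_algebra r"
  by (intro mixed_algebra.hol holomorphic_intros)

text \<open>
  Both derivatives of \<open>h\<close> and \<open>cnj h\<close> are again of these two kinds or zero; the rest is the product rule.
\<close>

lemma mixed_algebra_wirtinger: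
  assumes "e \<in> mixed_algebra r"
  shows "\<exists>d\<in>mixed_algebra r. \<exists>d'\<in>mixed_algebra r. \<forall>z\<in>ball 0 r. has_wirtinger e (d z) (d' z) z"
  using assms
proof induction
  case (hol h)
  then have "deriv h \<in> mixed_algebra r" by (intro mixed_algebra.hol holomorphic_deriv) auto
  moreover have "\<forall>z\<in>ball 0 r. has_wirtinger h (deriv h z) 0 z"
    using hol by (auto intro!: has_wirtinger_holomorphic holomorphic_derivI)
  ultimately show ?case
    by (intro bexI[of _ "deriv h"] bexI[of _ "\<lambda>_. 0"] mixed_algebra_const)
next
  case (cnj h)
  then have "(\<lambda>z. cnj (deriv h z)) \<in> mixed_algebra r" by (intro mixed_algebra.cnj holomorphic_deriv) auto
  moreover have "\<forall>z\<in>ball 0 r. has_wirtinger (\<lambda>z. cnj (h z)) 0 (cnj (deriv h z)) z"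
  proof
    fix z :: complex assume "z \<in> ball 0 r"
    with cnj have "has_wirtinger h (deriv h z) 0 z"
      by (auto intro!: has_wirtinger_holomorphic holomorphic_derivI)
    from has_wirtinger_cnj[OF this] show "has_wirtinger (\<lambda>z. cnj (h z)) 0 (cnj (deriv h z)) z" by simp
  qed
  ultimately show ?case
    by (intro bexI[of _ "\<lambda>_. 0"] bexI[of _ "\<lambda>z. cnj (deriv h z)"] mixed_algebra_const)
next
  case (add e f)
  then obtain d d' k k' where "d \<in> mixed_algebra r" "d' \<in> mixed_algebra r" "k \<in> mixed_algebra r" "k' \<in> mixed_algebra r"
    "\<forall>z\<in>ball 0 r. has_wirtinger e (d z) (d' z) z" "\<forall>z\<in>ball 0 r. has_wirtinger f (k z) (k' z) z" by blast
  then show ?case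
    by (intro bexI[of _ "\<lambda>z. d z + k z"] bexI[of _ "\<lambda>z. d' z + k' z"])
      (auto intro: has_wirtinger_add mixed_algebra.intros)
next
  case (mult e f)
  then obtain d d' k k' where *: "d \<in> mixed_algebra r" "d' \<in> mixed_algebra r" "k \<in> mixed_algebra r" "k' \<in> mixed_algebra r"
    "\<forall>z\<in>ball 0 r. has_wirtinger e (d z) (d' z) z" "\<forall>z\<in>ball 0 r. has_wirtinger f (k z) (k' z) z" by blast
  show ?case
  proof (intro bexI ballI)
    show "has_wirtinger (\<lambda>z. e z * f z) (d z * f z + e z * k z) (d' z * f z + e z * k' z) z"
      if "z \<in> ball 0 r" for z
      using * that by (intro has_wirtinger_mult) auto
  qed (intro mixed_algebra.add mixed_algebra.mult * mult.hyps)+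
qed

lemma mixed_algebra_isCont:
  assumes "e \<in> mixed_algebra r" "z \<in> ball 0 r"
  shows "isCont e z"
proof -
  obtain A B where "has_wirtinger e A B z"
    using mixed_algebra_wirtinger[OF assms(1)] assms(2) by blast
  then show ?thesis unfolding has_wirtinger_def by (rule has_derivative_continuous)
qed

lemma has_derivative_imp_linear_bound:
  fixes e :: "complex \<Rightarrow> complex"
  assumes "(e has_derivative e') (at 0)" "e 0 = 0"
  obtains K where "\<forall>\<^sub>F z in at 0. norm (e z) \<le> K * norm z"
proof -
  from assms(1) obtain K where K: "\<And>h. norm (e' h) \<le> norm h * K"
    using bounded_linear.bounded has_derivative_bounded_linear by blast
  have "((\<lambda>h. norm (e (0 + h) - e 0 - e' h) / norm h) \<longlongrightarrow> 0) (at 0)"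
    using assms(1) by (simp add: has_derivative_at)
  then have "\<forall>\<^sub>F h in at 0. norm (e (0 + h) - e 0 - e' h) / norm h < 1"
    by (rule order_tendstoD(2)) simp
  moreover have "\<forall>\<^sub>F h in at (0::complex). h \<noteq> 0" by (simp add: eventually_at_filter)
  ultimately have "\<forall>\<^sub>F z in at 0. norm (e z) \<le> (K + 1) * norm z"
  proof eventually_elim
    case (elim h)
    then have "norm (e h - e' h) < norm h" using assms(2) by (simp add: field_simps)
    then have "norm (e h) \<le> norm (e' h) + norm h" using norm_triangle_ineq2[of "e h" "e' h"] by simp
    with K[of h] show ?case by (simp add: algebra_simps)
  qed
  then show thesis by (rule that)
qed

lemma filterlim_norm_at_right_0: "filterlim norm (at_right 0) (at (0::complex))"
proof -
  have "(norm \<longlongrightarrow> 0) (at (0::complex))" using tendsto_norm[OF tendsto_ident_at[of 0]] by simp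
  moreover have "\<forall>\<^sub>F z in at (0::complex). norm z \<in> {0<..} - {0}"
    by (simp add: eventually_at_filter)
  ultimately show ?thesis by (simp add: filterlim_at eventually_at_filter)
qed

text \<open>
  The setting of the comparison of \<open>log L\<close> with \<open>log M\<close>, where \<open>M = L + Re Q\<close> is a perturbation of
  \<open>L = log (1/|z|)\<close> by a harmonic function.
\<close>

locale log_comparison =
  fixes r :: real and Q :: "complex \<Rightarrow> complex"
  assumes r: "0 < r" "r \<le> 1"
    and Q: "Q holomorphic_on ball 0 r"
    and M_pos': "\<And>z. z \<in> ball 0 r - {0} \<Longrightarrow> - ln (norm z) + Re (Q z) > 0"
begin

abbreviation "D \<equiv> ball 0 r - {0::complex}"
definition L :: "complex \<Rightarrow> real" where "L z = - ln (norm z)"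
definition M :: "complex \<Rightarrow> real" where "M z = L z + Re (Q z)"
definition X :: "complex \<Rightarrow> complex" where "X z = inverse (of_real (M z))"
definition Y :: "complex \<Rightarrow> complex" where "Y z = inverse (of_real (L z))"
text \<open>
  The holomorphic function with \<open>z \<partial>M = p\<close>.
\<close>

definition p :: "complex \<Rightarrow> complex" where "p z = (z * deriv Q z - 1) / 2"

lemma open_D: "open D" by auto

lemma L_pos: "z \<in> D \<Longrightarrow> L z > 0"
  using r by (auto simp: L_def intro!: ln_less_zero)

lemma M_pos: "z \<in> D \<Longrightarrow> M z > 0"
  using M_pos' by (simp add: M_def L_def)

lemma p_hol: "p holomorphic_on ball 0 r"
  unfolding p_def by (intro holomorphic_intros Q) auto

lemma p_0: "p 0 = -1/2" by (simp add: p_def)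

lemma has_wirtinger_L:
  assumes "z \<in> D"
  shows "has_wirtinger (\<lambda>z. of_real (L z)) (- 1 / 2 / z) (- 1 / 2 / cnj z) z"
  using has_wirtinger_mult[OF has_wirtinger_const[of "-1"] has_wirtinger_ln_norm[of z]] assms
  by (simp add: L_def)

lemma has_wirtinger_M:
  assumes "z \<in> D"
  shows "has_wirtinger (\<lambda>z. of_real (M z)) (p z / z) (cnj (p z) / cnj z) z"
proof -
  have q: "has_wirtinger Q (deriv Q z) 0 z"
    using Q assms by (auto intro!: has_wirtinger_holomorphic holomorphic_derivI)
  from has_wirtinger_mult[OF has_wirtinger_const[of "1/2"] has_wirtinger_add[OF q has_wirtinger_cnj[OF q]]]
  have "has_wirtinger (\<lambda>z. 1 / 2 * (Q z + cnj (Q z))) (deriv Q z / 2) (cnj (deriv Q z) / 2) z"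
    by simp
  from has_wirtinger_add[OF has_wirtinger_L[OF assms] this]
  have "has_wirtinger (\<lambda>z. of_real (L z) + 1 / 2 * (Q z + cnj (Q z)))
     (- 1 / 2 / z + deriv Q z / 2) (- 1 / 2 / cnj z + cnj (deriv Q z) / 2) z" .
  moreover have "(\<lambda>z. of_real (L z) + 1 / 2 * (Q z + cnj (Q z))) = (\<lambda>z. complex_of_real (M z))"
    by (simp add: M_def complex_add_cnj)
  moreover have "- 1 / 2 / z + deriv Q z / 2 = p z / z" "- 1 / 2 / cnj z + cnj (deriv Q z) / 2 = cnj (p z) / cnj z"
    using assms by (simp_all add: p_def field_simps)
  ultimately show ?thesis by simp
qed

lemma has_wirtinger_X_power:
  assumes "z \<in> D"
  shows "has_wirtinger (\<lambda>z. X z ^ i) (- of_nat i * p z * X z ^ Suc i / z)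
           (- of_nat i * cnj (p z) * X z ^ Suc i / cnj z) z"
proof (induction i)
  case (Suc i)
  have "has_wirtinger X (- (p z / z) * (X z)\<^sup>2) (- (cnj (p z) / cnj z) * (X z)\<^sup>2) z"
    unfolding X_def[abs_def]
    using M_pos[OF assms] by (intro has_wirtinger_inverse has_wirtinger_M assms) simp
  from has_wirtinger_mult[OF this Suc] show ?case
    using assms by (simp add: field_simps power2_eq_square)
qed (simp add: has_wirtinger_const)

lemma has_wirtinger_Y_power:
  assumes "z \<in> D"
  shows "has_wirtinger (\<lambda>z. Y z ^ i) (of_nat i / 2 * Y z ^ Suc i / z) (of_nat i / 2 * Y z ^ Suc i / cnj z) z"
proof (induction i)
  case (Suc i)
  have "has_wirtinger Y (- (- 1 / 2 / z) * (Y z)\<^sup>2) (- (- 1 / 2 / cnj z) * (Y z)\<^sup>2) z"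
    unfolding Y_def[abs_def]
    using L_pos[OF assms] by (intro has_wirtinger_inverse has_wirtinger_L assms) simp
  from has_wirtinger_mult[OF this Suc] show ?case
    using assms by (simp add: field_simps power2_eq_square)
qed (simp add: has_wirtinger_const)

text \<open>
  Remainder terms of order \<open>k\<close>: monomials in the two inverse logarithms \<open>X\<close> and \<open>Y\<close> of total degree
  at least \<open>k\<close>, together with monomials of any degree whose coefficient vanishes at the origin.
  The latter are \<open>O(|z|)\<close> and smaller than every power of an inverse logarithm.
\<close>

inductive_set higher_order :: "nat \<Rightarrow> (complex \<Rightarrow> complex) set" for k :: nat where
  monom: "e \<in> mixed_algebra r \<Longrightarrow> e 0 = 0 \<or> k \<le> i + j \<Longrightarrow> (\<lambda>z. e z * X z ^ i * Y z ^ j) \<in> higher_order k"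
| add: "F \<in> higher_order k \<Longrightarrow> G \<in> higher_order k \<Longrightarrow> (\<lambda>z. F z + G z) \<in> higher_order k"

lemma higher_order_cmult:
  assumes "F \<in> higher_order k"
  shows "(\<lambda>z. c * F z) \<in> higher_order k"
  using assms
proof induction
  case (monom e i j)
  have "(\<lambda>z. (c * e z) * X z ^ i * Y z ^ j) \<in> higher_order k"
    by (intro higher_order.monom mixed_algebra.mult mixed_algebra_const) (use monom in auto)
  then show ?case by (simp add: mult.assoc)
next
  case (add F G)
  then have "(\<lambda>z. c * F z + c * G z) \<in> higher_order k" by (intro higher_order.add)
  then show ?case by (simp add: algebra_simps)
qed

lemma higher_order_mono:
  assumes "F \<in> higher_order k" "l \<le> k"
  shows "F \<in> higher_order l"
  using assms
proof induction
  case (monom e i j)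
  then show ?case by (intro higher_order.monom) auto
qed (auto intro: higher_order.add)

text \<open>
  The operators \<open>z \<partial>\<close> and \<open>cnj z \<partial>'\<close> raise the order by one.  Applied to \<open>X\<close> or \<open>Y\<close> they raise the degree,
  and applied to a coefficient they leave a factor \<open>z\<close> or \<open>cnj z\<close>, which vanishes at the origin.
\<close>

lemma higher_order_wirtinger:
  assumes "F \<in> higher_order k"
  shows "\<exists>A\<in>higher_order (Suc k). \<exists>B\<in>higher_order (Suc k). \<forall>z\<in>D. has_wirtinger F (A z / z) (B z / cnj z) z"
  using assms
proof induction
  case (monom e i j)
  obtain d d' where d: "d \<in> mixed_algebra r" "d' \<in> mixed_algebra r"
    "\<forall>z\<in>ball 0 r. has_wirtinger e (d z) (d' z) z"
    using mixed_algebra_wirtinger[OF monom(1)] by blast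
  note alg = mixed_algebra.mult mixed_algebra_const mixed_algebra.hol[OF p_hol] mixed_algebra.cnj[OF p_hol]
    mixed_algebra.hol[OF holomorphic_on_ident] mixed_algebra.cnj[OF holomorphic_on_ident] monom(1) d(1,2)
  define A where "A = (\<lambda>z. (z * d z) * X z ^ i * Y z ^ j +
     ((e z * (- of_nat i * p z)) * X z ^ Suc i * Y z ^ j + (e z * (of_nat j / 2)) * X z ^ i * Y z ^ Suc j))"
  define B where "B = (\<lambda>z. (cnj z * d' z) * X z ^ i * Y z ^ j +
     ((e z * (- of_nat i * cnj (p z))) * X z ^ Suc i * Y z ^ j + (e z * (of_nat j / 2)) * X z ^ i * Y z ^ Suc j))"
  have A: "A \<in> higher_order (Suc k)"
    unfolding A_def by (intro higher_order.add higher_order.monom alg) (use monom(2) in auto)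
  have B: "B \<in> higher_order (Suc k)"
    unfolding B_def by (intro higher_order.add higher_order.monom alg) (use monom(2) in auto)
  have "has_wirtinger (\<lambda>z. e z * X z ^ i * Y z ^ j) (A z / z) (B z / cnj z) z" if z: "z \<in> D" for z
  proof -
    have "has_wirtinger e (d z) (d' z) z" using d(3) z by blast
    note w = has_wirtinger_mult[OF has_wirtinger_mult[OF this has_wirtinger_X_power[OF z]] has_wirtinger_Y_power[OF z]]
    have e1: "(d z * X z ^ i + e z * (- of_nat i * p z * X z ^ Suc i / z)) * Y z ^ j +
       e z * X z ^ i * (of_nat j / 2 * Y z ^ Suc j / z) = A z / z"
      using z by (simp add: A_def field_simps)
    have e2: "(d' z * X z ^ i + e z * (- of_nat i * cnj (p z) * X z ^ Suc i / cnj z)) * Y z ^ j +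
       e z * X z ^ i * (of_nat j / 2 * Y z ^ Suc j / cnj z) = B z / cnj z"
      using z by (simp add: B_def field_simps)
    from w[of i j] show ?thesis unfolding e1 e2 .
  qed
  with A B show ?case by blast
next
  case (add F G)
  then obtain A B A' B' where *: "A \<in> higher_order (Suc k)" "B \<in> higher_order (Suc k)" "A' \<in> higher_order (Suc k)" "B' \<in> higher_order (Suc k)"
    "\<forall>z\<in>D. has_wirtinger F (A z / z) (B z / cnj z) z" "\<forall>z\<in>D. has_wirtinger G (A' z / z) (B' z / cnj z) z" by blast
  show ?case
  proof (intro bexI ballI)
    show "has_wirtinger (\<lambda>z. F z + G z) ((A z + A' z) / z) ((B z + B' z) / cnj z) z" if "z \<in> D" for z
      unfolding add_divide_distrib using * that by (intro has_wirtinger_add) auto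
  qed (intro higher_order.add *)+
qed

lemma eventually_D: "\<forall>\<^sub>F z in at 0. z \<in> D"
  using eventually_at_in_open[of "ball 0 r" "0::complex"] r by simp

lemma Q_cont: "(Q \<longlongrightarrow> Q 0) (at 0)"
  using mixed_algebra_isCont[OF mixed_algebra.hol[OF Q], of 0] r by (simp add: isCont_def)

lemma Y_tendsto: "(Y \<longlongrightarrow> 0) (at 0)"
proof -
  have "((\<lambda>x::real. inverse (- ln x)) \<longlongrightarrow> 0) (at_right 0)" by real_asymp
  from filterlim_compose[OF this filterlim_norm_at_right_0]
  have "((\<lambda>z. complex_of_real (inverse (L z))) \<longlongrightarrow> of_real 0) (at 0)"
    unfolding L_def by (intro tendsto_of_real)
  then show ?thesis by (simp add: Y_def[abs_def] of_real_inverse)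
qed

text \<open>
  \<open>M/L = 1 + Re Q Y\<close>, and \<open>Q\<close> is bounded near the origin.
\<close>

lemma LX_tendsto: "((\<lambda>z. of_real (L z) * X z) \<longlongrightarrow> 1) (at 0)"
proof -
  have "((\<lambda>z. inverse (1 + of_real (Re (Q z)) * Y z)) \<longlongrightarrow> inverse (1 + of_real (Re (Q 0)) * 0)) (at 0)"
    by (intro tendsto_intros Q_cont Y_tendsto) auto
  then have "((\<lambda>z. inverse (1 + of_real (Re (Q z)) * Y z)) \<longlongrightarrow> 1) (at 0)" by simp
  then show ?thesis
  proof (rule Lim_transform_eventually)
    show "\<forall>\<^sub>F z in at 0. inverse (1 + of_real (Re (Q z)) * Y z) = of_real (L z) * X z"
      using eventually_D
    proof eventually_elim
      case (elim z)
      have "inverse (1 + Re (Q z) * inverse (L z)) = L z * inverse (M z)"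
        using L_pos[OF elim] M_pos[OF elim] by (simp add: M_def field_simps)
      from arg_cong[OF this, of complex_of_real] show ?case
        by (simp add: X_def Y_def of_real_inverse)
    qed
  qed
qed

lemma X_tendsto: "(X \<longlongrightarrow> 0) (at 0)"
proof -
  have "((\<lambda>z. Y z * (of_real (L z) * X z)) \<longlongrightarrow> 0 * 1) (at 0)"
    by (intro tendsto_mult Y_tendsto LX_tendsto)
  then show ?thesis
    unfolding mult_zero_left
  proof (rule Lim_transform_eventually)
    show "\<forall>\<^sub>F z in at 0. Y z * (of_real (L z) * X z) = X z"
      using eventually_D
    proof eventually_elim
      case (elim z)
      then show ?case using L_pos[of z] by (simp add: Y_def)
    qed
  qed
qed

lemma LY_eq: "z \<in> D \<Longrightarrow> of_real (L z) * Y z = 1"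
  using L_pos[of z] by (simp add: Y_def)

lemma norm_times_L_power_tendsto: "((\<lambda>z. norm z * L z ^ m) \<longlongrightarrow> 0) (at 0)"
proof -
  have "((\<lambda>t::real. t ^ m / exp t) \<longlongrightarrow> 0) at_top" by (rule tendsto_power_div_exp_0)
  moreover have "filterlim (\<lambda>x::real. - ln x) at_top (at_right 0)" by real_asymp
  ultimately have "((\<lambda>x::real. (- ln x) ^ m / exp (- ln x)) \<longlongrightarrow> 0) (at_right 0)"
    by (rule filterlim_compose)
  from filterlim_compose[OF this filterlim_norm_at_right_0]
  have "((\<lambda>z::complex. (- ln (norm z)) ^ m / exp (- ln (norm z))) \<longlongrightarrow> 0) (at 0)" .
  then show ?thesis
  proof (rule Lim_transform_eventually)
    show "\<forall>\<^sub>F z in at 0. (- ln (norm z)) ^ m / exp (- ln (norm z)) = norm z * L z ^ m"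
      using eventually_D by eventually_elim (simp add: L_def exp_minus divide_inverse mult.commute)
  qed
qed

text \<open>
  In \<open>L^k X^i Y^j\<close> each \<open>X\<close> and each \<open>Y\<close> absorbs one factor \<open>L\<close>; if \<open>i + j > k\<close>, then a positive
  power of \<open>Y\<close> is left over.  A coefficient that vanishes at \<open>0\<close> is \<open>O(|z|)\<close> and beats \<open>L^k\<close>.
\<close>

lemma higher_order_tendsto:
  assumes "F \<in> higher_order (Suc k)"
  shows "((\<lambda>z. of_real (L z ^ k) * F z) \<longlongrightarrow> 0) (at 0)"
  using assms
proof induction
  case (monom e i j)
  have econt: "(e \<longlongrightarrow> e 0) (at 0)"
    using mixed_algebra_isCont[OF monom(1), of 0] r by (simp add: isCont_def)
  show ?case
  proof (cases "e 0 = 0")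
    case True
    obtain A B where "has_wirtinger e A B 0"
      using mixed_algebra_wirtinger[OF monom(1)] r by fastforce
    then obtain K where K: "\<forall>\<^sub>F z in at 0. norm (e z) \<le> K * norm z"
      using has_derivative_imp_linear_bound[of e "\<lambda>h. A * h + B * cnj h"] True
      unfolding has_wirtinger_def by blast
    have "((\<lambda>z. of_real (L z ^ k) * e z) \<longlongrightarrow> 0) (at 0)"
    proof (rule Lim_null_comparison)
      show "((\<lambda>z. K * (norm z * L z ^ k)) \<longlongrightarrow> 0) (at 0)"
        using tendsto_mult_left[OF norm_times_L_power_tendsto[of k], of K] by simp
      show "\<forall>\<^sub>F z in at 0. norm (of_real (L z ^ k) * e z) \<le> K * (norm z * L z ^ k)"
        using K eventually_D
      proof eventually_elim
        case (elim z)
        have "L z ^ k * norm (e z) \<le> L z ^ k * (K * norm z)"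
          using elim(1) L_pos[OF elim(2)] by (intro mult_left_mono) auto
        then show ?case using L_pos[OF elim(2)] by (simp add: norm_mult norm_power mult_ac)
      qed
    qed
    from tendsto_mult[OF tendsto_mult[OF this tendsto_power[OF X_tendsto, of i]] tendsto_power[OF Y_tendsto, of j]]
    show ?thesis by (simp add: mult.assoc)
  next
    case False
    with monom(2) have le: "Suc k \<le> i + j" by simp
    define l where "l = i + j - k"
    have l: "i + j = k + l" "l > 0" using le by (auto simp: l_def)
    have "((\<lambda>z. e z * (of_real (L z) * X z) ^ i * Y z ^ l) \<longlongrightarrow> e 0 * 1 ^ i * 0 ^ l) (at 0)"
      by (intro tendsto_intros econt LX_tendsto Y_tendsto)
    then have "((\<lambda>z. e z * (of_real (L z) * X z) ^ i * Y z ^ l) \<longlongrightarrow> 0) (at 0)"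
      using l by (simp add: zero_power)
    then show ?thesis
    proof (rule Lim_transform_eventually)
      show "\<forall>\<^sub>F z in at 0. e z * (of_real (L z) * X z) ^ i * Y z ^ l = of_real (L z ^ k) * (e z * X z ^ i * Y z ^ j)"
        using eventually_D
      proof eventually_elim
        case (elim z)
        have "of_real (L z) ^ i * Y z ^ l = of_real (L z) ^ i * Y z ^ l * (of_real (L z) * Y z) ^ j * (of_real (L z) * Y z) ^ k"
          by (simp add: LY_eq[OF elim])
        also have "\<dots> = of_real (L z) ^ (i + j) * (of_real (L z) ^ k * Y z ^ (k + l) * Y z ^ j)"
          by (simp add: power_mult_distrib power_add mult_ac)
        also have "\<dots> = (of_real (L z) * Y z) ^ (i + j) * (of_real (L z) ^ k * Y z ^ j)"
          by (simp add: l(1)[symmetric] power_mult_distrib mult_ac)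
        also have "\<dots> = of_real (L z ^ k) * Y z ^ j"
          by (simp add: LY_eq[OF elim])
        finally show ?case by (simp add: power_mult_distrib mult_ac)
      qed
    qed
  qed
next
  case (add F G)
  from tendsto_add[OF add.IH] show ?case by (simp add: algebra_simps)
qed

end

section \<open>Expansion of the iterated derivatives\<close>

text \<open>
  The recursions \<open>G_(n+1) = z \<partial>G_n - n G_n\<close> for \<open>G_n = z^n \<partial>^n w\<close> and
  \<open>K_(m+1) = cnj z \<partial>'K_m - m K_m\<close> in the conjugate variable.
\<close>

lemma has_wirtinger_divide_powers:
  assumes z: "z \<noteq> 0" and G: "has_wirtinger G (A / z) (B / cnj z) z"
  shows "has_wirtinger (\<lambda>z. G z / (z ^ n * cnj z ^ m))
    ((A - of_nat n * G z) / (z ^ Suc n * cnj z ^ m)) ((B - of_nat m * G z) / (z ^ n * cnj z ^ Suc m)) z"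
proof -
  have h: "has_wirtinger (\<lambda>z. 1 / z ^ k) (- of_nat k / z ^ Suc k) 0 z" for k
  proof (rule has_wirtinger_holomorphic)
    show "((\<lambda>z. 1 / z ^ k) has_field_derivative - of_nat k / z ^ Suc k) (at z)"
    proof (cases k)
      case (Suc l)
      have "((\<lambda>z. z ^ k) has_field_derivative of_nat k * z ^ l) (at z)"
        by (rule DERIV_cong[OF DERIV_power[OF DERIV_ident]]) (simp add: Suc)
      from DERIV_inverse_fun[OF this] z show ?thesis
        by (simp add: Suc field_simps del: of_nat_Suc)
    qed simp
  qed
  have c: "has_wirtinger (\<lambda>z. 1 / cnj z ^ m) 0 (- of_nat m / cnj z ^ Suc m) z"
    using has_wirtinger_cnj[OF h[of m]] by simp
  have "has_wirtinger (\<lambda>z. G z * (1 / z ^ n * (1 / cnj z ^ m)))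
     (A / z * (1 / z ^ n * (1 / cnj z ^ m)) + G z * (- of_nat n / z ^ Suc n * (1 / cnj z ^ m) + 1 / z ^ n * 0))
     (B / cnj z * (1 / z ^ n * (1 / cnj z ^ m)) + G z * (0 * (1 / cnj z ^ m) + 1 / z ^ n * (- of_nat m / cnj z ^ Suc m))) z"
    by (intro has_wirtinger_mult G h c)
  moreover have "A / z * (1 / z ^ n * (1 / cnj z ^ m)) + G z * (- of_nat n / z ^ Suc n * (1 / cnj z ^ m) + 1 / z ^ n * 0)
      = (A - of_nat n * G z) / (z ^ Suc n * cnj z ^ m)"
    using z by (simp add: field_simps)
  moreover have "B / cnj z * (1 / z ^ n * (1 / cnj z ^ m)) + G z * (0 * (1 / cnj z ^ m) + 1 / z ^ n * (- of_nat m / cnj z ^ Suc m))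
      = (B - of_nat m * G z) / (z ^ n * cnj z ^ Suc m)"
    using z by (simp add: field_simps)
  moreover have "(\<lambda>z. G z * (1 / z ^ n * (1 / cnj z ^ m))) = (\<lambda>z. G z / (z ^ n * cnj z ^ m))"
    by (simp add: fun_eq_iff)
  ultimately show ?thesis by (simp only:)
qed

context log_comparison
begin

text \<open>
  The difference of the two inverse logarithms is of second order.  This is why the leading
  terms of \<open>log L\<close> and \<open>log M\<close> cancel and only the value of \<open>Re Q\<close> at the origin survives.
\<close>

lemma Y_minus_X:
  assumes "z \<in> D"
  shows "Y z - X z = of_real (Re (Q z)) * X z * Y z"
proof -
  have "inverse (L z) - inverse (M z) = Re (Q z) * inverse (M z) * inverse (L z)"
    using L_pos[OF assms] M_pos[OF assms] by (simp add: M_def field_simps)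
  from arg_cong[OF this, of complex_of_real] show ?thesis
    by (simp add: X_def Y_def of_real_inverse)
qed

lemma Re_Q_mixed: "(\<lambda>z. complex_of_real (Re (Q z))) \<in> mixed_algebra r"
proof -
  have "(\<lambda>z. 1 / 2 * (Q z + cnj (Q z))) \<in> mixed_algebra r"
    by (intro mixed_algebra.intros mixed_algebra_const Q)
  then show ?thesis by (simp add: complex_add_cnj)
qed

lemma higher_order_diff: "F \<in> higher_order k \<Longrightarrow> G \<in> higher_order k \<Longrightarrow> (\<lambda>z. F z - G z) \<in> higher_order k"
  using higher_order.add[OF _ higher_order_cmult[of G k "-1"], of F] by simp

lemma higher_order_monom_const: "k \<le> i + j \<Longrightarrow> (\<lambda>z. c * X z ^ i * Y z ^ j) \<in> higher_order k"
  by (intro higher_order.monom mixed_algebra_const) auto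

context
  fixes H w :: "complex \<Rightarrow> complex" and q0 :: real
  assumes Q0: "Re (Q 0) = q0" and H: "H \<in> mixed_algebra r"
    and w: "\<And>z. z \<in> D \<Longrightarrow> w z = H z + of_real (ln (L z)) - of_real (ln (M z))"
begin

text \<open>
  \<open>z \<partial>w = z \<partial>H - Y/2 - p X = z \<partial>H - (p + 1/2) X - (Y - X)/2\<close>.  The first two terms have
  coefficients that vanish at the origin, and the last one is \<open>-(Re Q) X Y / 2\<close>.
\<close>

lemma wirtinger_expansion_first:
  "\<exists>G\<in>higher_order 2. (\<lambda>z. G z - of_real (- q0 / 2) * X z * Y z) \<in> higher_order 3 \<and> (\<forall>z\<in>D. wirtinger w z = G z / z)"
proof -
  obtain d d' where d: "d \<in> mixed_algebra r" "\<And>z. z \<in> ball 0 r \<Longrightarrow> has_wirtinger H (d z) (d' z) z"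
    using mixed_algebra_wirtinger[OF H] by blast
  note alg = mixed_algebra.mult mixed_algebra.add mixed_algebra_const mixed_algebra.hol[OF p_hol]
    mixed_algebra.hol[OF holomorphic_on_ident] Re_Q_mixed d(1)
  define q where "q = (\<lambda>z. complex_of_real (Re (Q z)))"
  \<comment> \<open>\<open>S\<close> collects the monomials with coefficients that
    vanish at the origin; it is of every order.\<close>
  define S where "S = (\<lambda>z. (z * d z) * X z ^ 0 * Y z ^ 0 + ((-1) * (p z + 1 / 2)) * X z ^ 1 * Y z ^ 0)"
  define G where "G = (\<lambda>z. S z + (- 1 / 2 * q z) * X z ^ 1 * Y z ^ 1)"
  have S: "S \<in> higher_order k" for k
    unfolding S_def by (intro higher_order.add higher_order.monom alg) (auto simp: p_0)
  have "G \<in> higher_order 2"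
    unfolding G_def q_def by (intro higher_order.add S higher_order.monom alg) auto
  moreover have "(\<lambda>z. G z - of_real (- q0 / 2) * X z * Y z) \<in> higher_order 3"
  proof -
    have "(\<lambda>z. S z + (- 1 / 2 * q z + of_real (q0 / 2)) * X z ^ 1 * Y z ^ 1) \<in> higher_order 3"
      unfolding q_def by (intro higher_order.add S higher_order.monom alg) (auto simp: Q0)
    then show ?thesis by (simp add: G_def algebra_simps)
  qed
  moreover have "wirtinger w z = G z / z" if z: "z \<in> D" for z
  proof -
    have hL: "has_wirtinger (\<lambda>z. of_real (ln (L z))) (- 1 / 2 / z / of_real (L z)) (- 1 / 2 / cnj z / of_real (L z)) z"
      by (intro has_wirtinger_of_real_ln has_wirtinger_L L_pos z)
    have hM: "has_wirtinger (\<lambda>z. of_real (ln (M z))) (p z / z / of_real (M z)) (cnj (p z) / cnj z / of_real (M z)) z"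
      by (intro has_wirtinger_of_real_ln has_wirtinger_M M_pos z)
    have "has_wirtinger H (d z) (d' z) z" using d(2) z by blast
    from has_wirtinger_add[OF has_wirtinger_add[OF this hL] has_wirtinger_mult[OF has_wirtinger_const[of "-1"] hM]]
    have "has_wirtinger (\<lambda>z. H z + of_real (ln (L z)) + (- 1) * of_real (ln (M z)))
       (d z + - 1 / 2 / z / of_real (L z) - p z / z / of_real (M z))
       (d' z + - 1 / 2 / cnj z / of_real (L z) - cnj (p z) / cnj z / of_real (M z)) z" by simp
    from has_wirtinger_transform[OF this open_D z, of w]
    have "wirtinger w z = d z + - 1 / 2 / z / of_real (L z) - p z / z / of_real (M z)"
      using w by (intro wirtinger_eqI(1)) simp
    also have "\<dots> = d z + - 1 / 2 / z * Y z - p z / z * X z"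
      by (simp only: X_def Y_def divide_inverse)
    also have "\<dots> = (z * d z - 1 / 2 * Y z - p z * X z) / z"
      using z by (simp add: field_simps)
    also have "z * d z - 1 / 2 * Y z - p z * X z = z * d z - (p z + 1 / 2) * X z - 1 / 2 * (Y z - X z)"
      by (simp add: algebra_simps)
    also have "\<dots> = G z"
      unfolding Y_minus_X[OF z] by (simp add: G_def S_def q_def algebra_simps)
    finally show ?thesis .
  qed
  ultimately show ?thesis by blast
qed

text \<open>
  If \<open>G_n\<close> has order 2, then \<open>z \<partial>G_n\<close> has order 3, and the recursion
  \<open>G_(n+1) = z \<partial>G_n - n G_n\<close> multiplies the leading coefficient by \<open>-n\<close>.
\<close>

lemma wirtinger_expansion:
  "\<exists>G\<in>higher_order 2. (\<lambda>z. G z - of_real ((-1) ^ Suc n * fact n * q0 / 2) * X z * Y z) \<in> higher_order 3 \<and>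
     (\<forall>z\<in>D. (wirtinger ^^ Suc n) w z = G z / z ^ Suc n)"
proof (induction n)
  case 0
  then show ?case using wirtinger_expansion_first by simp
next
  case (Suc n)
  define c where "c = complex_of_real ((-1) ^ Suc n * fact n * q0 / 2)"
  from Suc obtain G where G: "G \<in> higher_order 2" "(\<lambda>z. G z - c * X z * Y z) \<in> higher_order 3"
      "\<And>z. z \<in> D \<Longrightarrow> (wirtinger ^^ Suc n) w z = G z / z ^ Suc n"
    unfolding c_def by blast
  obtain A B where AB: "A \<in> higher_order 3" "\<And>z. z \<in> D \<Longrightarrow> has_wirtinger G (A z / z) (B z / cnj z) z"
    using higher_order_wirtinger[OF G(1)] by fastforce
  define G' where "G' = (\<lambda>z. A z - of_nat (Suc n) * G z)"
  have "G' \<in> higher_order 2"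
    unfolding G'_def by (intro higher_order_diff higher_order_cmult G higher_order_mono[OF AB(1)]) simp
  moreover have "(\<lambda>z. G' z - of_real ((-1) ^ Suc (Suc n) * fact (Suc n) * q0 / 2) * X z * Y z) \<in> higher_order 3"
  proof -
    have "(\<lambda>z. A z - of_nat (Suc n) * (G z - c * X z * Y z)) \<in> higher_order 3"
      by (intro higher_order_diff higher_order_cmult G AB)
    also have "(\<lambda>z. A z - of_nat (Suc n) * (G z - c * X z * Y z)) =
        (\<lambda>z. G' z - of_real ((-1) ^ Suc (Suc n) * fact (Suc n) * q0 / 2) * X z * Y z)"
      by (simp add: G'_def c_def algebra_simps)
    finally show ?thesis .
  qed
  moreover have "(wirtinger ^^ Suc (Suc n)) w z = G' z / z ^ Suc (Suc n)" if z: "z \<in> D" for z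
  proof -
    have "z \<noteq> 0" using z by simp
    from has_wirtinger_transform[OF has_wirtinger_divide_powers[OF this AB(2)[OF z], of "Suc n" 0] open_D z, of "(wirtinger ^^ Suc n) w"]
    have "has_wirtinger ((wirtinger ^^ Suc n) w)
      ((A z - of_nat (Suc n) * G z) / (z ^ Suc (Suc n) * cnj z ^ 0))
      ((B z - of_nat 0 * G z) / (z ^ Suc n * cnj z ^ Suc 0)) z"
      using G(3) by simp
    from wirtinger_eqI(1)[OF this] show ?thesis by (simp add: G'_def)
  qed
  ultimately show ?case by blast
qed

text \<open>
  Here the derivative of the leading term itself matters:
  \<open>cnj z \<partial>'(X Y) = -cnj p X^2 Y + X Y^2 / 2\<close>, which is \<open>(X^2 Y + X Y^2) / 2\<close> up to the term
  with coefficient \<open>cnj p + 1/2\<close>, and this coefficient vanishes at the origin.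
\<close>

lemma wirtinger_bar_expansion_first:
  fixes n :: nat
  defines "c \<equiv> complex_of_real ((-1) ^ Suc n * fact n * q0 / 2)"
  shows "\<exists>K\<in>higher_order 3. (\<lambda>z. K z - c / 2 * (X z ^ 2 * Y z + X z * Y z ^ 2)) \<in> higher_order 4 \<and>
     (\<forall>z\<in>D. wirtinger_bar ((wirtinger ^^ Suc n) w) z = K z / (z ^ Suc n * cnj z))"
proof -
  obtain G where G: "(\<lambda>z. G z - c * X z * Y z) \<in> higher_order 3"
      "\<And>z. z \<in> D \<Longrightarrow> (wirtinger ^^ Suc n) w z = G z / z ^ Suc n"
    using wirtinger_expansion[of n] unfolding c_def by blast
  define R where "R = (\<lambda>z. G z - c * X z * Y z)"
  have "R \<in> higher_order 3" using G(1) unfolding R_def .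
  then obtain A B where AB: "B \<in> higher_order 4" "\<And>z. z \<in> D \<Longrightarrow> has_wirtinger R (A z / z) (B z / cnj z) z"
    using higher_order_wirtinger[of R 3] by fastforce
  note alg = mixed_algebra.mult mixed_algebra.add mixed_algebra_const mixed_algebra.cnj[OF p_hol]
  define T where "T = (\<lambda>z. (- c * (cnj (p z) + 1 / 2)) * X z ^ 2 * Y z ^ 1)"
  have T: "T \<in> higher_order 4"
    unfolding T_def by (intro higher_order.monom alg) (auto simp: p_0)
  define K where "K = (\<lambda>z. B z + T z + (c / 2 * X z ^ 2 * Y z ^ 1 + c / 2 * X z ^ 1 * Y z ^ 2))"
  have "K \<in> higher_order 3"
    unfolding K_def by (intro higher_order.add higher_order_monom_const higher_order_mono[OF AB(1)] higher_order_mono[OF T]) auto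
  moreover have "(\<lambda>z. K z - c / 2 * (X z ^ 2 * Y z + X z * Y z ^ 2)) \<in> higher_order 4"
    using higher_order.add[OF AB(1) T] by (simp add: K_def algebra_simps)
  moreover have "wirtinger_bar ((wirtinger ^^ Suc n) w) z = K z / (z ^ Suc n * cnj z)" if z: "z \<in> D" for z
  proof -
    have z0: "z \<noteq> 0" using z by simp
    note XY = has_wirtinger_mult[OF has_wirtinger_X_power[OF z, of 1] has_wirtinger_Y_power[OF z, of 1]]
    define A' where "A' = A z + c * (- p z * X z ^ 2 * Y z + X z * Y z ^ 2 / 2)"
    have "has_wirtinger (\<lambda>z. R z + c * (X z * Y z)) (A' / z) (K z / cnj z) z"
    proof -
      have "has_wirtinger (\<lambda>z. R z + c * (X z ^ 1 * Y z ^ 1))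
        (A z / z + (0 * (X z ^ 1 * Y z ^ 1) + c * (- of_nat 1 * p z * X z ^ Suc 1 / z * Y z ^ 1 + X z ^ 1 * (of_nat 1 / 2 * Y z ^ Suc 1 / z))))
        (B z / cnj z + (0 * (X z ^ 1 * Y z ^ 1) + c * (- of_nat 1 * cnj (p z) * X z ^ Suc 1 / cnj z * Y z ^ 1 + X z ^ 1 * (of_nat 1 / 2 * Y z ^ Suc 1 / cnj z)))) z"
        by (intro has_wirtinger_add has_wirtinger_mult[OF has_wirtinger_const] AB(2) z XY)
      moreover have "A z / z + (0 * (X z ^ 1 * Y z ^ 1) + c * (- of_nat 1 * p z * X z ^ Suc 1 / z * Y z ^ 1 + X z ^ 1 * (of_nat 1 / 2 * Y z ^ Suc 1 / z))) = A' / z"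
        using z0 by (simp add: A'_def field_simps power2_eq_square)
      moreover have "B z / cnj z + (0 * (X z ^ 1 * Y z ^ 1) + c * (- of_nat 1 * cnj (p z) * X z ^ Suc 1 / cnj z * Y z ^ 1 + X z ^ 1 * (of_nat 1 / 2 * Y z ^ Suc 1 / cnj z))) = K z / cnj z"
        using z0 by (simp add: K_def T_def field_simps power2_eq_square)
      ultimately show ?thesis by simp
    qed
    moreover have "(\<lambda>z. R z + c * (X z * Y z)) = G" by (simp add: R_def mult.assoc)
    ultimately have "has_wirtinger G (A' / z) (K z / cnj z) z" by simp
    from has_wirtinger_transform[OF has_wirtinger_divide_powers[OF z0 this, of "Suc n" 0] open_D z, of "(wirtinger ^^ Suc n) w"]
    have "has_wirtinger ((wirtinger ^^ Suc n) w)
      ((A' - of_nat (Suc n) * G z) / (z ^ Suc (Suc n) * cnj z ^ 0))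
      ((K z - of_nat 0 * G z) / (z ^ Suc n * cnj z ^ Suc 0)) z"
      using G(2) by simp
    from wirtinger_eqI(2)[OF this] show ?thesis by simp
  qed
  ultimately show ?thesis by blast
qed

text \<open>
  As in the holomorphic variable: from order 3 on, \<open>cnj z \<partial>'\<close> contributes order 4 only, and the
  recursion multiplies the leading coefficient by \<open>-m\<close>.
\<close>

lemma wirtinger_bar_expansion:
  fixes n m :: nat
  defines "c \<equiv> complex_of_real ((-1) ^ Suc n * fact n * q0 / 2)"
  shows "\<exists>K\<in>higher_order 3. (\<lambda>z. K z - (-1) ^ m * fact m * c / 2 * (X z ^ 2 * Y z + X z * Y z ^ 2)) \<in> higher_order 4 \<and>
     (\<forall>z\<in>D. (wirtinger_bar ^^ Suc m) ((wirtinger ^^ Suc n) w) z = K z / (z ^ Suc n * cnj z ^ Suc m))"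
proof (induction m)
  case 0
  then show ?case using wirtinger_bar_expansion_first[of n] by (simp add: c_def)
next
  case (Suc m)
  let ?f = "(wirtinger_bar ^^ Suc m) ((wirtinger ^^ Suc n) w)"
  define e where "e = (-1) ^ m * fact m * c / 2"
  from Suc obtain K where K: "K \<in> higher_order 3" "(\<lambda>z. K z - e * (X z ^ 2 * Y z + X z * Y z ^ 2)) \<in> higher_order 4"
      "\<And>z. z \<in> D \<Longrightarrow> ?f z = K z / (z ^ Suc n * cnj z ^ Suc m)"
    unfolding e_def by blast
  obtain A B where AB: "B \<in> higher_order 4" "\<And>z. z \<in> D \<Longrightarrow> has_wirtinger K (A z / z) (B z / cnj z) z"
    using higher_order_wirtinger[OF K(1)] by fastforce
  define K' where "K' = (\<lambda>z. B z - of_nat (Suc m) * K z)"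
  have "K' \<in> higher_order 3"
    unfolding K'_def by (intro higher_order_diff higher_order_cmult K higher_order_mono[OF AB(1)]) simp
  moreover have "(\<lambda>z. K' z - (-1) ^ Suc m * fact (Suc m) * c / 2 * (X z ^ 2 * Y z + X z * Y z ^ 2)) \<in> higher_order 4"
  proof -
    have "(\<lambda>z. B z - of_nat (Suc m) * (K z - e * (X z ^ 2 * Y z + X z * Y z ^ 2))) \<in> higher_order 4"
      by (intro higher_order_diff higher_order_cmult K AB)
    also have "(\<lambda>z. B z - of_nat (Suc m) * (K z - e * (X z ^ 2 * Y z + X z * Y z ^ 2))) =
        (\<lambda>z. K' z - (-1) ^ Suc m * fact (Suc m) * c / 2 * (X z ^ 2 * Y z + X z * Y z ^ 2))"
    proof -
      have "(-1) ^ Suc m * fact (Suc m) * c / 2 = - of_nat (Suc m) * e"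
        by (simp add: e_def algebra_simps)
      then show ?thesis unfolding K'_def by (simp only:) (simp add: algebra_simps)
    qed
    finally show ?thesis .
  qed
  moreover have "(wirtinger_bar ^^ Suc (Suc m)) ((wirtinger ^^ Suc n) w) z = K' z / (z ^ Suc n * cnj z ^ Suc (Suc m))"
    if z: "z \<in> D" for z
  proof -
    have z0: "z \<noteq> 0" using z by simp
    from has_wirtinger_transform[OF has_wirtinger_divide_powers[OF z0 AB(2)[OF z], of "Suc n" "Suc m"] open_D z, of ?f]
    have "has_wirtinger ?f
      ((A z - of_nat (Suc n) * K z) / (z ^ Suc (Suc n) * cnj z ^ Suc m))
      ((B z - of_nat (Suc m) * K z) / (z ^ Suc n * cnj z ^ Suc (Suc m))) z"
      using K(3) by simp
    from wirtinger_eqI(2)[OF this] show ?thesis by (simp add: K'_def)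
  qed
  ultimately show ?case by blast
qed

lemma L_eq: "z \<in> D \<Longrightarrow> ln (1 / norm z) = L z"
  by (simp add: L_def ln_div)

text \<open>
  \<open>L^2 X Y\<close> tends to \<open>1\<close>, and terms of order 3 disappear against \<open>L^2\<close>.
\<close>

lemma wirtinger_limit:
  assumes "n \<ge> 1"
  shows "((\<lambda>z. z ^ n * of_real ((ln (1 / norm z)) ^ 2) * (wirtinger ^^ n) w z)
            \<longlongrightarrow> of_real ((-1) ^ n * fact (n - 1) * q0 / 2)) (at 0)"
proof -
  obtain n' where n': "n = Suc n'" using assms by (cases n) auto
  define c where "c = complex_of_real ((-1) ^ Suc n' * fact n' * q0 / 2)"
  obtain G where G: "(\<lambda>z. G z - c * X z * Y z) \<in> higher_order 3"
      "\<And>z. z \<in> D \<Longrightarrow> (wirtinger ^^ Suc n') w z = G z / z ^ Suc n'"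
    using wirtinger_expansion[of n'] unfolding c_def by blast
  have "((\<lambda>z. of_real (L z ^ 2) * (G z - c * X z * Y z)) \<longlongrightarrow> 0) (at 0)"
    using G(1) by (intro higher_order_tendsto) (simp add: numeral_3_eq_3 numeral_2_eq_2)
  from tendsto_add[OF this tendsto_mult[OF tendsto_const[of c] LX_tendsto]]
  have "((\<lambda>z. of_real (L z ^ 2) * (G z - c * X z * Y z) + c * (of_real (L z) * X z)) \<longlongrightarrow> c) (at 0)"
    by simp
  then have "((\<lambda>z. z ^ n * of_real ((ln (1 / norm z)) ^ 2) * (wirtinger ^^ n) w z) \<longlongrightarrow> c) (at 0)"
  proof (rule Lim_transform_eventually)
    show "\<forall>\<^sub>F z in at 0. of_real (L z ^ 2) * (G z - c * X z * Y z) + c * (of_real (L z) * X z) =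
       z ^ n * of_real ((ln (1 / norm z)) ^ 2) * (wirtinger ^^ n) w z"
      using eventually_D
    proof eventually_elim
      case (elim z)
      have "of_real (L z ^ 2) * (G z - c * X z * Y z) + c * (of_real (L z) * X z) =
         of_real (L z ^ 2) * G z + c * (of_real (L z) * X z) * (1 - of_real (L z) * Y z)"
        by (simp add: algebra_simps power2_eq_square)
      then show ?case
        unfolding n' G(2)[OF elim] L_eq[OF elim] using elim by (simp add: LY_eq)
    qed
  qed
  then show ?thesis by (simp add: c_def n')
qed

text \<open>
  \<open>L^3 (X^2 Y + X Y^2)\<close> tends to \<open>2\<close>, and terms of order 4 disappear against \<open>L^3\<close>.
\<close>

lemma wirtinger_bar_limit:
  assumes "n \<ge> 1" "m \<ge> 1"
  shows "((\<lambda>z. z ^ n * cnj z ^ m * of_real ((ln (1 / norm z)) ^ 3)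
                * (wirtinger_bar ^^ m) ((wirtinger ^^ n) w) z)
            \<longlongrightarrow> of_real ((-1) ^ (m + n - 1) * fact (n - 1) * fact (m - 1) * q0 / 2)) (at 0)"
proof -
  obtain n' m' where n': "n = Suc n'" and m': "m = Suc m'" using assms by (cases n; cases m) auto
  define c where "c = (-1) ^ m' * fact m' * complex_of_real ((-1) ^ Suc n' * fact n' * q0 / 2) / 2"
  obtain K where K: "(\<lambda>z. K z - c * (X z ^ 2 * Y z + X z * Y z ^ 2)) \<in> higher_order 4"
      "\<And>z. z \<in> D \<Longrightarrow> (wirtinger_bar ^^ Suc m') ((wirtinger ^^ Suc n') w) z = K z / (z ^ Suc n' * cnj z ^ Suc m')"
    using wirtinger_bar_expansion[of m' n'] unfolding c_def by blast
  have "((\<lambda>z. of_real (L z ^ 3) * (K z - c * (X z ^ 2 * Y z + X z * Y z ^ 2))) \<longlongrightarrow> 0) (at 0)"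
    using K(1) by (intro higher_order_tendsto) simp
  from tendsto_add[OF this tendsto_mult[OF tendsto_const[of c] tendsto_add[OF tendsto_power[OF LX_tendsto, of 2] LX_tendsto]]]
  have "((\<lambda>z. of_real (L z ^ 3) * (K z - c * (X z ^ 2 * Y z + X z * Y z ^ 2))
      + c * ((of_real (L z) * X z) ^ 2 + of_real (L z) * X z)) \<longlongrightarrow> 2 * c) (at 0)"
    by (simp add: mult.commute[of c 2])
  then have "((\<lambda>z. z ^ n * cnj z ^ m * of_real ((ln (1 / norm z)) ^ 3)
                * (wirtinger_bar ^^ m) ((wirtinger ^^ n) w) z) \<longlongrightarrow> 2 * c) (at 0)"
  proof (rule Lim_transform_eventually)
    show "\<forall>\<^sub>F z in at 0. of_real (L z ^ 3) * (K z - c * (X z ^ 2 * Y z + X z * Y z ^ 2))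
      + c * ((of_real (L z) * X z) ^ 2 + of_real (L z) * X z) =
       z ^ n * cnj z ^ m * of_real ((ln (1 / norm z)) ^ 3) * (wirtinger_bar ^^ m) ((wirtinger ^^ n) w) z"
      using eventually_D
    proof eventually_elim
      case (elim z)
      have "l ^ 3 * (k - c * (x ^ 2 * y + x * y ^ 2)) + c * ((l * x) ^ 2 + l * x) =
          l ^ 3 * k + c * ((l * x) ^ 2 * (1 - l * y) + l * x * (1 - (l * y) ^ 2))" for l k x y :: complex
        by (simp add: algebra_simps power2_eq_square power3_eq_cube)
      from this[of "of_real (L z)" "K z" "X z" "Y z"] have
        "of_real (L z ^ 3) * (K z - c * (X z ^ 2 * Y z + X z * Y z ^ 2))
           + c * ((of_real (L z) * X z) ^ 2 + of_real (L z) * X z) = of_real (L z ^ 3) * K z"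
        by (simp only: LY_eq[OF elim] of_real_power power_one diff_self mult_zero_right add_0_right)
      then show ?case
        unfolding n' m' K(2)[OF elim] L_eq[OF elim] using elim by simp
    qed
  qed
  then show ?thesis by (simp add: c_def n' m' power_add mult_ac)
qed

end

end

section \<open>The density near the origin and the theorem\<close>

text \<open>
  Since \<open>\<phi> = 1 + O(x)\<close>, the hypothesis says that \<open>(B C + 1) ln x + B g(0)\<close> converges; as \<open>ln x\<close> is
  unbounded, its coefficient is zero, and the limit is \<open>B g(0)\<close>.
\<close>

lemma log_coefficients:
  fixes \<phi> g :: "complex \<Rightarrow> complex" and B \<kappa> :: real and C :: complex
  assumes \<phi>: "(\<phi> has_field_derivative \<phi>') (at 0)" "\<phi> 0 = 1" and g: "isCont g 0"
    and lim: "((\<lambda>x. of_real B * (\<phi> (of_real x) * (C * of_real (ln x) + g (of_real x))) + of_real (ln x))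
                 \<longlongrightarrow> of_real \<kappa>) (at_right (0::real))"
  shows "of_real B * C = -1" "of_real B * g 0 = of_real \<kappa>"
proof -
  have real_to: "filterlim complex_of_real (at 0) (at_right 0)"
    by (auto simp: filterlim_at eventually_at_filter intro!: tendsto_eq_intros)
  have l1: "((\<lambda>x. (\<phi> (of_real x) - 1) * complex_of_real (ln x)) \<longlongrightarrow> 0) (at_right 0)"
  proof -
    have "((\<lambda>z. (\<phi> z - 1) / z) \<longlongrightarrow> \<phi>') (at 0)"
      using \<phi> by (simp add: has_field_derivative_iff)
    from filterlim_compose[OF this real_to]
    have "((\<lambda>x. (\<phi> (of_real x) - 1) / of_real x) \<longlongrightarrow> \<phi>') (at_right (0::real))" .
    moreover have "((\<lambda>x::real. x * ln x) \<longlongrightarrow> 0) (at_right 0)" by real_asymp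
    then have "((\<lambda>x. complex_of_real (x * ln x)) \<longlongrightarrow> of_real 0) (at_right 0)" by (rule tendsto_of_real)
    ultimately have "((\<lambda>x. (\<phi> (of_real x) - 1) / of_real x * complex_of_real (x * ln x)) \<longlongrightarrow> \<phi>' * of_real 0) (at_right 0)"
      by (rule tendsto_mult)
    then have "((\<lambda>x. (\<phi> (of_real x) - 1) / of_real x * complex_of_real (x * ln x)) \<longlongrightarrow> 0) (at_right 0)"
      by simp
    then show ?thesis
    proof (rule Lim_transform_eventually)
      show "\<forall>\<^sub>F x in at_right 0. (\<phi> (of_real x) - 1) / of_real x * complex_of_real (x * ln x)
          = (\<phi> (of_real x) - 1) * complex_of_real (ln x)"
        by (simp add: eventually_at_filter)
    qed
  qed
  have "isCont \<phi> 0" using \<phi>(1) by (rule DERIV_isCont)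
  then have l2: "((\<lambda>x. \<phi> (of_real x) * g (of_real x)) \<longlongrightarrow> g 0) (at_right (0::real))"
    using tendsto_mult[OF filterlim_compose[OF _ real_to, of \<phi> "nhds (\<phi> 0)"] filterlim_compose[OF _ real_to, of g "nhds (g 0)"]]
      g \<phi>(2) by (simp add: isCont_def)
  define E where "E = of_real B * C + 1"
  have "((\<lambda>x. (of_real B * (\<phi> (of_real x) * (C * of_real (ln x) + g (of_real x))) + of_real (ln x))
      - of_real B * C * ((\<phi> (of_real x) - 1) * of_real (ln x)) - of_real B * (\<phi> (of_real x) * g (of_real x)))
      \<longlongrightarrow> of_real \<kappa> - of_real B * C * 0 - of_real B * g 0) (at_right (0::real))"
    by (intro tendsto_intros lim l1 l2)
  also have "(\<lambda>x. (of_real B * (\<phi> (of_real x) * (C * of_real (ln x) + g (of_real x))) + of_real (ln x))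
      - of_real B * C * ((\<phi> (of_real x) - 1) * of_real (ln x)) - of_real B * (\<phi> (of_real x) * g (of_real x)))
     = (\<lambda>x. E * complex_of_real (ln x))"
    by (simp add: E_def algebra_simps)
  finally have lE: "((\<lambda>x. E * complex_of_real (ln x)) \<longlongrightarrow> of_real \<kappa> - of_real B * g 0) (at_right (0::real))"
    by simp
  have "((\<lambda>x::real. inverse (ln x)) \<longlongrightarrow> 0) (at_right 0)" by real_asymp
  then have "((\<lambda>x. complex_of_real (inverse (ln x))) \<longlongrightarrow> of_real 0) (at_right 0)" by (rule tendsto_of_real)
  from tendsto_mult[OF lE this]
  have "((\<lambda>x. E * complex_of_real (ln x) * of_real (inverse (ln x))) \<longlongrightarrow> 0) (at_right 0)" by simp
  moreover have "\<forall>\<^sub>F x in at_right (0::real). E * complex_of_real (ln x) * of_real (inverse (ln x)) = E"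
  proof -
    have "\<forall>\<^sub>F x in at_right (0::real). x \<in> {0<..<1}" by (rule eventually_at_right_real) simp
    then show ?thesis
    proof eventually_elim
      case (elim x)
      then have "ln x \<noteq> 0" by simp
      then show ?case by (simp add: of_real_inverse)
    qed
  qed
  ultimately have "((\<lambda>x::real. E) \<longlongrightarrow> 0) (at_right 0)" by (rule Lim_transform_eventually)
  then have E: "E = 0" by (simp add: tendsto_const_iff)
  then show "of_real B * C = -1" by (simp add: E_def eq_neg_iff_add_eq_0)
  have "((\<lambda>x::real. 0) \<longlongrightarrow> of_real \<kappa> - of_real B * g 0) (at_right 0)" using lE E by simp
  then show "of_real B * g 0 = of_real \<kappa>" by (simp add: tendsto_const_iff)
qed

lemma one_minus_in_slit_plane:
  "1 - z \<in> - complex_of_real ` {1..} \<longleftrightarrow> z \<notin> \<real>\<^sub>\<le>\<^sub>0"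
  by (auto simp: branch_cut_eq complex_nonpos_Reals_iff)

text \<open>
  The hypergeometric equation with parameters \<open>a, b, c\<close> goes over into that with
  \<open>a, b, a + b + 1 - c\<close> under \<open>z \<mapsto> 1 - z\<close>; the value \<open>c = a + b\<close> thus leads to \<open>c = 1\<close>,
  the equation solved by \<open>\<phi>1\<close>.
\<close>

lemma reflected_hypergeo_F:
  assumes ab: "0 < a" "0 < b"
  defines "\<phi> \<equiv> \<lambda>u. hypergeo_F (of_real a) (of_real b) (of_real (a + b)) (1 - u)"
  shows "\<phi> holomorphic_on - \<real>\<^sub>\<le>\<^sub>0"
    and "z \<notin> \<real>\<^sub>\<le>\<^sub>0 \<Longrightarrow> z * (1 - z) * deriv (deriv \<phi>) z
           + (1 - (of_real (a + b) + 1) * z) * deriv \<phi> z - of_real (a * b) * \<phi> z = 0"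
    and "z \<notin> \<real>\<^sub>\<le>\<^sub>0 \<Longrightarrow> \<phi> (cnj z) = cnj (\<phi> z)"
proof -
  let ?S = "- complex_of_real ` {1..}"
  define f where "f = hypergeo_F (of_real a) (of_real b) (of_real (a + b))"
  have bc: "0 < b" "b < a + b" using ab by auto
  have f: "f holomorphic_on ?S" unfolding f_def by (rule holomorphic_hypergeo_F[OF bc])
  have \<phi>: "\<phi> = (\<lambda>u. f (1 - u))" by (simp add: \<phi>_def f_def)
  have o: "open (- \<real>\<^sub>\<le>\<^sub>0 :: complex set)" by (intro open_Compl closed_nonpos_Reals_complex)
  have dm: "((\<lambda>u. 1 - u) has_field_derivative -1) (at z)" for z :: complex
    by (auto intro!: derivative_eq_intros)
  have d1: "((\<lambda>u. f (1 - u)) has_field_derivative - deriv f (1 - z)) (at z)" if "z \<notin> \<real>\<^sub>\<le>\<^sub>0" for z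
  proof -
    have "1 - z \<in> ?S" using that by (simp only: one_minus_in_slit_plane not_False_eq_True)
    then have "(f has_field_derivative deriv f (1 - z)) (at (1 - z))"
      by (rule holomorphic_derivI[OF f open_slit_plane])
    from DERIV_chain2[where f = f and g = "\<lambda>u. 1 - u", OF this dm] show ?thesis by simp
  qed
  have d1': "deriv \<phi> z = - deriv f (1 - z)" if "z \<notin> \<real>\<^sub>\<le>\<^sub>0" for z
    unfolding \<phi> using d1[OF that] by (rule DERIV_imp_deriv)
  show "\<phi> holomorphic_on - \<real>\<^sub>\<le>\<^sub>0"
    unfolding \<phi> holomorphic_on_open[OF o] using d1 by blast
  have d2: "deriv (deriv \<phi>) z = deriv (deriv f) (1 - z)" if z: "z \<notin> \<real>\<^sub>\<le>\<^sub>0" for z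
  proof (rule DERIV_imp_deriv)
    have "1 - z \<in> ?S" using z by (simp only: one_minus_in_slit_plane not_False_eq_True)
    then have "(deriv f has_field_derivative deriv (deriv f) (1 - z)) (at (1 - z))"
      by (rule holomorphic_derivI[OF holomorphic_deriv[OF f open_slit_plane] open_slit_plane])
    from DERIV_minus[OF DERIV_chain2[where f = "deriv f" and g = "\<lambda>u. 1 - u", OF this dm]]
    have "((\<lambda>u. - deriv f (1 - u)) has_field_derivative deriv (deriv f) (1 - z)) (at z)" by simp
    then show "(deriv \<phi> has_field_derivative deriv (deriv f) (1 - z)) (at z)"
      by (rule has_field_derivative_transform_within_open[OF _ o]) (use z d1' in auto)
  qed
  show "z * (1 - z) * deriv (deriv \<phi>) z
           + (1 - (of_real (a + b) + 1) * z) * deriv \<phi> z - of_real (a * b) * \<phi> z = 0" if z: "z \<notin> \<real>\<^sub>\<le>\<^sub>0"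
  proof -
    have "1 - z \<in> ?S" using z by (simp only: one_minus_in_slit_plane not_False_eq_True)
    from hypergeo_F_ode[OF bc this, of a]
    have "(1 - z) * (1 - (1 - z)) * deriv (deriv f) (1 - z)
       + (of_real (a + b) - of_real (a + b + 1) * (1 - z)) * deriv f (1 - z) - of_real (a * b) * f (1 - z) = 0"
      unfolding f_def .
    then show ?thesis
      unfolding d2[OF z] d1'[OF z] by (simp add: \<phi> algebra_simps)
  qed
  show "\<phi> (cnj z) = cnj (\<phi> z)" if z: "z \<notin> \<real>\<^sub>\<le>\<^sub>0"
  proof -
    have "1 - z \<in> ?S" using z by (simp only: one_minus_in_slit_plane not_False_eq_True)
    from hypergeo_F_cnj[OF bc this, of a] show ?thesis by (simp add: \<phi>_def)
  qed
qed

text \<open>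
  The connection formula between the two singular points: reduction of order gives its shape, and
  the behaviour on the positive axis near \<open>0\<close> determines the constants.
\<close>

lemma reflected_hypergeo_F_log_expansion:
  assumes ab: "0 < a" "a < 1" "0 < b" "b < 1"
  defines "\<phi>1 \<equiv> hypergeo_F (of_real a) (of_real b) 1"
    and "\<phi>2 \<equiv> \<lambda>u. hypergeo_F (of_real a) (of_real b) (of_real (a + b)) (1 - u)"
  obtains r g where "0 < r" "r \<le> 1" "g holomorphic_on ball 0 r" "\<And>z. z \<in> ball 0 r \<Longrightarrow> \<phi>1 z \<noteq> 0"
    "\<And>z. z \<in> ball 0 r - \<real>\<^sub>\<le>\<^sub>0 \<Longrightarrow> of_real (Beta a b) * \<phi>2 z = \<phi>1 z * (- Ln z + g z)"
    "g 0 = of_real (2 * Digamma 1 - Digamma a - Digamma b)"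
proof -
  have bc: "0 < b" "b < 1" using ab(3,4) by auto
  have \<phi>1: "\<phi>1 = hypergeo_F (of_real a) (of_real b) (of_real 1)" by (simp add: \<phi>1_def)
  have hol1: "\<phi>1 holomorphic_on ball 0 1"
    unfolding \<phi>1 by (rule holomorphic_on_subset[OF holomorphic_hypergeo_F[OF bc] ball_subset_slit_plane])
  have \<phi>10: "\<phi>1 0 = 1" unfolding \<phi>1 by (rule hypergeo_F_0[OF bc])
  have ode1: "z * (1 - z) * deriv (deriv \<phi>1) z + (1 - (of_real (a + b) + 1) * z) * deriv \<phi>1 z - of_real (a * b) * \<phi>1 z = 0"
    if "z \<in> ball 0 1" for z
    using hypergeo_F_ode[OF bc subsetD[OF ball_subset_slit_plane that], of a, folded \<phi>1] by simp
  have hol2: "\<phi>2 holomorphic_on - \<real>\<^sub>\<le>\<^sub>0"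
    unfolding \<phi>2_def by (rule reflected_hypergeo_F(1)[OF ab(1,3)])
  have ode2: "z * (1 - z) * deriv (deriv \<phi>2) z + (1 - (of_real (a + b) + 1) * z) * deriv \<phi>2 z - of_real (a * b) * \<phi>2 z = 0"
    if "z \<notin> \<real>\<^sub>\<le>\<^sub>0" for z
    unfolding \<phi>2_def by (rule reflected_hypergeo_F(2)[OF ab(1,3) that])
  obtain r C g where r: "0 < r" "r \<le> 1" and g: "g holomorphic_on ball 0 r"
    and nz: "\<And>z. z \<in> ball 0 r \<Longrightarrow> \<phi>1 z \<noteq> 0"
    and eq: "\<And>z. z \<in> ball 0 r - \<real>\<^sub>\<le>\<^sub>0 \<Longrightarrow> \<phi>2 z = \<phi>1 z * (C * Ln z + g z)"
    using logarithmic_second_solution[OF hol1 \<phi>10 hol2 ode1 ode2] by metis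
  define \<kappa> where "\<kappa> = 2 * Digamma 1 - Digamma a - Digamma b"
  define F where "F = (\<lambda>x. Re (\<phi>2 (of_real x)))"
  have F: "(\<lambda>n. pochhammer a n * pochhammer b n / (pochhammer (a + b) n * fact n) * (1 - x) ^ n) sums F x"
    and F': "\<phi>2 (of_real x) = of_real (F x)" if x: "0 < x" "x < 1" for x
  proof -
    have "norm (complex_of_real (1 - x)) < 1" using x by (simp only: norm_of_real)
    from hypergeo_F_sums[OF ab(3) _ this, of "a + b" a]
    have *: "(\<lambda>n. complex_of_real (pochhammer a n * pochhammer b n / (pochhammer (a + b) n * fact n) * (1 - x) ^ n))
       sums \<phi>2 (of_real x)"
      using ab(1) by (simp add: \<phi>2_def)
    from sums_Re[OF this] show 1: "(\<lambda>n. pochhammer a n * pochhammer b n / (pochhammer (a + b) n * fact n) * (1 - x) ^ n) sums F x"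
      by (simp only: F_def Re_complex_of_real)
    from sums_of_real[OF this] * show "\<phi>2 (of_real x) = of_real (F x)" by (rule sums_unique2[rotated])
  qed
  have "((\<lambda>x. Beta a b * F x + ln x) \<longlongrightarrow> \<kappa>) (at_right 0)"
    unfolding \<kappa>_def using ab F by (intro log_asymptotics_at_one) auto
  then have "((\<lambda>x. complex_of_real (Beta a b * F x + ln x)) \<longlongrightarrow> of_real \<kappa>) (at_right 0)"
    by (rule tendsto_of_real)
  then have lim: "((\<lambda>x. of_real (Beta a b) * (\<phi>1 (of_real x) * (C * of_real (ln x) + g (of_real x))) + of_real (ln x))
                 \<longlongrightarrow> of_real \<kappa>) (at_right (0::real))"
  proof (rule Lim_transform_eventually)
    have "\<forall>\<^sub>F x in at_right (0::real). x \<in> {0<..<r}" by (rule eventually_at_right_real) (rule r)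
    then show "\<forall>\<^sub>F x in at_right (0::real). complex_of_real (Beta a b * F x + ln x) =
        of_real (Beta a b) * (\<phi>1 (of_real x) * (C * of_real (ln x) + g (of_real x))) + of_real (ln x)"
    proof eventually_elim
      case (elim x)
      have "of_real (F x) = \<phi>2 (of_real x)" using F' elim r by simp
      also have "\<dots> = \<phi>1 (of_real x) * (C * Ln (of_real x) + g (of_real x))"
        using elim by (intro eq) (simp add: complex_nonpos_Reals_iff)
      also have "Ln (complex_of_real x) = of_real (ln x)" using elim by (simp add: Ln_of_real)
      finally show ?case by simp
    qed
  qed
  have 0: "(0::complex) \<in> ball 0 r" "(0::complex) \<in> ball 0 1" using r by auto
  have gc: "isCont g 0"
    using holomorphic_on_imp_continuous_on[OF g] 0(1) by (simp add: continuous_on_eq_continuous_at)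
  note coeff = log_coefficients[OF holomorphic_derivI[OF hol1 open_ball 0(2)] \<phi>10 gc lim]
  show thesis
  proof (rule that[OF r, of "\<lambda>z. of_real (Beta a b) * g z"])
    show "(\<lambda>z. of_real (Beta a b) * g z) holomorphic_on ball 0 r" by (intro holomorphic_intros g)
    show "of_real (Beta a b) * g 0 = of_real (2 * Digamma 1 - Digamma a - Digamma b)"
      using coeff(2) by (simp only: \<kappa>_def)
    show "of_real (Beta a b) * \<phi>2 z = \<phi>1 z * (- Ln z + of_real (Beta a b) * g z)" if "z \<in> ball 0 r - \<real>\<^sub>\<le>\<^sub>0" for z
    proof -
      have "of_real (Beta a b) * \<phi>2 z = \<phi>1 z * (of_real (Beta a b) * C * Ln z + of_real (Beta a b) * g z)"
        unfolding eq[OF that] by (simp add: algebra_simps)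
      then show ?thesis unfolding coeff(1) by simp
    qed
  qed (rule nz)
qed

lemma cot_sum_eq_Digamma:
  assumes "0 < a" "a < 1" "0 < b" "b < (1::real)"
  shows "pi * sin (pi * (a + b)) / (sin (pi * a) * sin (pi * b)) =
     Digamma (1 - a) - Digamma a + (Digamma (1 - b) - Digamma b)"
proof -
  have "sin (pi * a) > 0" "sin (pi * b) > 0" using assms by (auto intro!: sin_gt_zero)
  then show ?thesis
    unfolding Digamma_reflection_real[OF assms(1,2)] Digamma_reflection_real[OF assms(3,4)]
    by (simp add: distrib_left sin_add field_simps)
qed

lemma density_slits_iff:
  "z \<in> density_slits \<longleftrightarrow> Im z = 0 \<and> (Re z \<le> 0 \<or> Re z \<ge> 1)"
proof
  assume "Im z = 0 \<and> (Re z \<le> 0 \<or> Re z \<ge> 1)"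
  then show "z \<in> density_slits"
    unfolding density_slits_def by (intro image_eqI[of _ _ "Re z"]) (auto simp: complex_eq_iff)
qed (auto simp: density_slits_def)

text \<open>
  Points of the slits are limits of points off the slits, hence a function that is continuous on an open
  set and agrees with the formula off the slits gives the extension on the slits as well.
\<close>

lemma hyperbolic_density_1_eqI:
  assumes U: "open U" "z \<in> U" and l: "isCont l z"
    and eq: "\<And>u. u \<in> U \<Longrightarrow> u \<notin> density_slits \<Longrightarrow> hyperbolic_density_formula \<beta> \<gamma> u = l u"
  shows "hyperbolic_density_1 \<beta> \<gamma> z = l z"
proof (cases "z \<in> density_slits")
  case True
  have "z islimpt - density_slits"
    unfolding islimpt_approachable
  proof (intro allI impI)
    fix e :: real assume e: "e > 0"
    \<comment> \<open>Both slits are real, so a vertical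
      displacement leaves them.\<close>
    show "\<exists>x'\<in>- density_slits. x' \<noteq> z \<and> dist x' z < e"
      using e True by (intro bexI[of _ "z + \<i> * of_real (e / 2)"]) (auto simp: density_slits_iff dist_norm norm_mult)
  qed
  then have nt: "at z within - density_slits \<noteq> bot" by (simp add: trivial_limit_within)
  have "(l \<longlongrightarrow> l z) (at z within - density_slits)"
    using l unfolding isCont_def by (rule tendsto_within_subset) simp
  then have "(hyperbolic_density_formula \<beta> \<gamma> \<longlongrightarrow> l z) (at z within - density_slits)"
  proof (rule Lim_transform_eventually)
    show "\<forall>\<^sub>F u in at z within - density_slits. l u = hyperbolic_density_formula \<beta> \<gamma> u"
      unfolding eventually_at_topological using U eq by (intro exI[of _ U]) auto
  qed
  then have "Lim (at z within - density_slits) (hyperbolic_density_formula \<beta> \<gamma>) = l z"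
    by (rule tendsto_Lim[OF nt])
  then show ?thesis using True by (simp add: hyperbolic_density_1_def)
qed (use eq U in \<open>simp add: hyperbolic_density_1_def\<close>)

text \<open>
  By the conjugation symmetry the denominator is \<open>K1 |\<phi>1|^2 + 2 Re (cnj \<phi>1 \<phi>2)\<close>, and the connection
  formula replaces \<open>\<phi>2\<close>.  Only the real part \<open>ln |z|\<close> of \<open>Ln z\<close> survives, and with it the jump
  across the negative axis is gone.
\<close>

lemma hyperbolic_density_formula_near_zero:
  fixes \<beta> \<gamma> a b :: real
  assumes ab: "0 < a" "a < 1" "0 < b" "b < 1" "a = (1 + \<beta> - \<gamma>) / 2" "b = (\<beta> + \<gamma> - 1) / 2"
  obtains r Q \<phi> where "0 < r" "r \<le> 1" "Q holomorphic_on ball 0 r" "\<phi> holomorphic_on ball 0 r" "\<phi> 0 = 1"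
    "\<And>z. z \<in> ball 0 r \<Longrightarrow> \<phi> z \<noteq> 0" "Re (Q 0) = (G_fun a + G_fun b) / 2"
    "\<And>z. z \<in> ball 0 r - \<real>\<^sub>\<le>\<^sub>0 \<Longrightarrow> hyperbolic_density_formula \<beta> \<gamma> z =
       1 / norm z * (1 / norm (1 - z) powr \<beta>) * (1 / (2 * (norm (\<phi> z))\<^sup>2 * (- ln (norm z) + Re (Q z))))"
proof -
  define \<phi>1 where "\<phi>1 = hypergeo_F (of_real a) (of_real b) 1"
  define \<phi>2 where "\<phi>2 = (\<lambda>u. hypergeo_F (of_real a) (of_real b) (of_real (a + b)) (1 - u))"
  obtain r g where r: "0 < r" "r \<le> 1" and g: "g holomorphic_on ball 0 r"
    and nz: "\<And>z. z \<in> ball 0 r \<Longrightarrow> \<phi>1 z \<noteq> 0"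
    and eq: "\<And>z. z \<in> ball 0 r - \<real>\<^sub>\<le>\<^sub>0 \<Longrightarrow> of_real (Beta a b) * \<phi>2 z = \<phi>1 z * (- Ln z + g z)"
    and g0: "g 0 = of_real (2 * Digamma 1 - Digamma a - Digamma b)"
    unfolding \<phi>1_def \<phi>2_def
  proof (rule reflected_hypergeo_F_log_expansion[OF ab(1-4)], goal_cases)
    case prems: (1 r g)
    show ?case by (rule prems(1)[OF prems(2-7)])
  qed
  have bc: "0 < b" "b < 1" using ab(3,4) by auto
  have \<phi>1: "\<phi>1 = hypergeo_F (of_real a) (of_real b) (of_real 1)" by (simp add: \<phi>1_def)
  have r1: "ball 0 r \<subseteq> (ball 0 1 :: complex set)" using r by (intro subset_ball)
  have rS: "ball 0 r \<subseteq> - complex_of_real ` {1..}" using r1 ball_subset_slit_plane by (rule subset_trans)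
  define S where "S = pi * sin (pi * (a + b)) / (sin (pi * a) * sin (pi * b))"
  define Q where "Q = (\<lambda>z. g z - of_real (S / 2))"
  define B where "B = Beta a b"
  have B: "B > 0" unfolding B_def using ab by (intro Beta_real_pos)
  show thesis
  proof (rule that[OF r, of Q \<phi>1])
    show "Q holomorphic_on ball 0 r" unfolding Q_def by (intro holomorphic_intros g)
    show "\<phi>1 holomorphic_on ball 0 r"
      unfolding \<phi>1 by (rule holomorphic_on_subset[OF holomorphic_hypergeo_F[OF bc] rS])
    show "\<phi>1 0 = 1" unfolding \<phi>1 by (rule hypergeo_F_0[OF bc])
    show "Re (Q 0) = (G_fun a + G_fun b) / 2"
      unfolding Q_def g0 of_real_diff[symmetric] Re_complex_of_real S_def cot_sum_eq_Digamma[OF ab(1-4)]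
      by (simp add: G_fun_def field_simps)
    show "hyperbolic_density_formula \<beta> \<gamma> z =
       1 / norm z * (1 / norm (1 - z) powr \<beta>) * (1 / (2 * (norm (\<phi>1 z))\<^sup>2 * (- ln (norm z) + Re (Q z))))"
      if z: "z \<in> ball 0 r - \<real>\<^sub>\<le>\<^sub>0" for z
    proof -
      have z': "z \<notin> \<real>\<^sub>\<le>\<^sub>0" "z \<noteq> 0" "z \<in> ball 0 r" using z by auto
      have c1: "\<phi>1 (cnj z) = cnj (\<phi>1 z)"
        unfolding \<phi>1 by (rule hypergeo_F_cnj[OF bc subsetD[OF rS z'(3)]])
      have c2: "\<phi>2 (cnj z) = cnj (\<phi>2 z)"
        unfolding \<phi>2_def by (rule reflected_hypergeo_F(3)[OF ab(1,3) z'(1)])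
      define N where "N = (norm (\<phi>1 z))\<^sup>2"
      define T where "T = - ln (norm z) + Re (Q z)"
      have "B * Re (cnj (\<phi>1 z) * \<phi>2 z) = Re (cnj (\<phi>1 z) * (of_real B * \<phi>2 z))"
        by (simp add: algebra_simps)
      also have "of_real B * \<phi>2 z = \<phi>1 z * (- Ln z + g z)" unfolding B_def by (rule eq[OF z])
      also have "cnj (\<phi>1 z) * (\<phi>1 z * (- Ln z + g z)) = of_real N * (- Ln z + g z)"
        unfolding N_def complex_norm_square by (simp add: mult_ac)
      also have "Re \<dots> = N * (- ln (norm z) + Re (g z))" using z'(2) by simp
      finally have *: "B * Re (cnj (\<phi>1 z) * \<phi>2 z) = N * (- ln (norm z) + Re (g z))" .
      have "Re (of_real (- S / B * N) + \<phi>1 z * \<phi>2 (cnj z) + \<phi>1 (cnj z) * \<phi>2 z)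
           = - S / B * N + 2 * Re (cnj (\<phi>1 z) * \<phi>2 z)"
        unfolding c1 c2 by (simp add: algebra_simps)
      also have "\<dots> = 2 * N * T / B"
      proof -
        have "Re (cnj (\<phi>1 z) * \<phi>2 z) = N * (- ln (norm z) + Re (g z)) / B"
          using * B by (simp add: field_simps)
        then show ?thesis unfolding T_def Q_def
          using B by (simp only:) (simp add: field_simps)
      qed
      finally have D: "Re (of_real (- S / B * N) + \<phi>1 z * \<phi>2 (cnj z) + \<phi>1 (cnj z) * \<phi>2 z) = 2 * N * T / B" .
      have "hyperbolic_density_formula \<beta> \<gamma> z = 1 / norm z * (1 / norm (1 - z) powr \<beta>) *
         ((1 / B) / Re (of_real (- S / B * N) + \<phi>1 z * \<phi>2 (cnj z) + \<phi>1 (cnj z) * \<phi>2 z))"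
        unfolding hyperbolic_density_formula_def Let_def ab(5,6)[symmetric] B_def S_def N_def \<phi>1_def \<phi>2_def ..
      also have "(1 / B) / Re (of_real (- S / B * N) + \<phi>1 z * \<phi>2 (cnj z) + \<phi>1 (cnj z) * \<phi>2 z) = 1 / (2 * N * T)"
        unfolding D using B by simp
      finally show ?thesis unfolding N_def T_def .
    qed
  qed (rule nz)
qed

text \<open>
  The expression for the density is smooth across the negative axis and so describes the density
  on a whole punctured disc.  The disc is shrunk until \<open>M\<close> is positive and \<open>\<phi>1\<close> has positive real
  part; then \<open>log |1 - z|\<close> and \<open>log |\<phi>1|\<close> are real parts of holomorphic functions.
\<close>

lemma remainder_w_decomposition:
  fixes \<beta> \<gamma> a b :: real
  assumes ab: "0 < a" "a < 1" "0 < b" "b < 1" "a = (1 + \<beta> - \<gamma>) / 2" "b = (\<beta> + \<gamma> - 1) / 2"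
  obtains r Q H where "log_comparison r Q" "Re (Q 0) = (G_fun a + G_fun b) / 2" "H \<in> mixed_algebra r"
    "\<And>z. z \<in> ball 0 r - {0} \<Longrightarrow> complex_of_real (remainder_w \<beta> \<gamma> z) =
        H z + of_real (ln (- ln (norm z))) - of_real (ln (- ln (norm z) + Re (Q z)))"
proof -
  obtain r0 Q \<phi> where r0: "0 < r0" "r0 \<le> 1" and Q: "Q holomorphic_on ball 0 r0"
    and \<phi>: "\<phi> holomorphic_on ball 0 r0" "\<phi> 0 = 1" "\<And>z. z \<in> ball 0 r0 \<Longrightarrow> \<phi> z \<noteq> 0"
    and Q0: "Re (Q 0) = (G_fun a + G_fun b) / 2"
    and form: "\<And>z. z \<in> ball 0 r0 - \<real>\<^sub>\<le>\<^sub>0 \<Longrightarrow> hyperbolic_density_formula \<beta> \<gamma> z =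
       1 / norm z * (1 / norm (1 - z) powr \<beta>) * (1 / (2 * (norm (\<phi> z))\<^sup>2 * (- ln (norm z) + Re (Q z))))"
    using hyperbolic_density_formula_near_zero[OF ab] by metis
  have 0: "(0::complex) \<in> ball 0 r0" using r0 by simp
  have cont: "f \<midarrow>0\<rightarrow> f 0" if "f holomorphic_on ball 0 r0" for f :: "complex \<Rightarrow> complex"
    using holomorphic_on_imp_continuous_on[OF that] 0 by (simp add: continuous_on_eq_continuous_at isCont_def)
  have ev1: "\<forall>\<^sub>F z in at 0. - ln (norm z) + Re (Q z) > 0"
  proof -
    have "filterlim (\<lambda>x::real. - ln x) at_top (at_right 0)" by real_asymp
    from filterlim_compose[OF this filterlim_norm_at_right_0]
    have "filterlim (\<lambda>z::complex. - ln (norm z)) at_top (at 0)" .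
    from filterlim_tendsto_add_at_top[OF tendsto_Re[OF cont[OF Q]] this]
    have "\<forall>\<^sub>F z in at 0. Re (Q z) + - ln (norm z) > 0"
      unfolding filterlim_at_top_dense by blast
    then show ?thesis by eventually_elim simp
  qed
  have ev2: "\<forall>\<^sub>F z in at 0. Re (\<phi> z) > 0"
    using order_tendstoD(1)[OF tendsto_Re[OF cont[OF \<phi>(1)]], of 0] \<phi>(2) by simp
  from eventually_conj[OF ev1 ev2] obtain \<delta> where \<delta>: "\<delta> > 0"
    "\<And>z. z \<noteq> 0 \<Longrightarrow> norm z < \<delta> \<Longrightarrow> - ln (norm z) + Re (Q z) > 0 \<and> Re (\<phi> z) > 0"
    unfolding eventually_at by (auto simp: dist_norm)
  define r where "r = min r0 \<delta>"
  have r: "0 < r" "r \<le> 1" using r0 \<delta>(1) by (auto simp: r_def)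
  have sub: "ball 0 r \<subseteq> (ball 0 r0 :: complex set)" by (intro subset_ball) (simp add: r_def)
  have M: "- ln (norm z) + Re (Q z) > 0" if "z \<in> ball 0 r - {0}" for z
    using \<delta>(2)[of z] that by (simp add: r_def)
  have P: "\<phi> z \<notin> \<real>\<^sub>\<le>\<^sub>0" if "z \<in> ball 0 r" for z
    using \<delta>(2)[of z] that \<phi>(2) by (cases "z = 0") (auto simp: r_def complex_nonpos_Reals_iff)
  have one: "1 - z \<notin> \<real>\<^sub>\<le>\<^sub>0" if "z \<in> ball 0 r" for z :: complex
    using that r abs_Re_le_cmod[of z] by (auto simp: complex_nonpos_Reals_iff)
  define h where "h = (\<lambda>z. - of_real (\<beta> / 2) * Ln (1 - z) - of_real (ln 2 / 2) - Ln (\<phi> z))"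
  have h: "h holomorphic_on ball 0 r"
    unfolding h_def by (intro holomorphic_intros holomorphic_on_subset[OF \<phi>(1) sub] one P)
  define l where "l = (\<lambda>z. 1 / norm z * (1 / norm (1 - z) powr \<beta>) * (1 / (2 * (norm (\<phi> z))\<^sup>2 * (- ln (norm z) + Re (Q z)))))"
  have dens: "hyperbolic_density_1 \<beta> \<gamma> z = l z" if z: "z \<in> ball 0 r - {0}" for z
  proof (rule hyperbolic_density_1_eqI[of "ball 0 r - {0}"])
    have zz: "z \<in> ball 0 r" "z \<noteq> 0" using z by auto
    have c: "isCont f z" if "f holomorphic_on ball 0 r0" for f
      using holomorphic_on_imp_continuous_on[OF that] zz sub
      by (auto simp: continuous_on_eq_continuous_at)
    have n: "norm (1 - z) \<noteq> 0" using one[OF zz(1)] by auto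
    show "isCont l z"
      unfolding l_def
      using zz(2) n M[OF z] \<phi>(3)[of z] subsetD[OF sub zz(1)]
      by (intro continuous_intros isCont_Re c[OF Q] c[OF \<phi>(1)]) auto
    show "hyperbolic_density_formula \<beta> \<gamma> u = l u" if "u \<in> ball 0 r - {0}" "u \<notin> density_slits" for u
    proof -
      have "u \<notin> \<real>\<^sub>\<le>\<^sub>0" using that(2) by (auto simp: density_slits_iff complex_nonpos_Reals_iff)
      then show ?thesis unfolding l_def using that(1) sub by (intro form) auto
    qed
  qed (use z in auto)
  show thesis
  proof (rule that[of r Q "\<lambda>z. h z + cnj (h z)"])
    show "log_comparison r Q"
      by unfold_locales (use r M holomorphic_on_subset[OF Q sub] in auto)
    show "Re (Q 0) = (G_fun a + G_fun b) / 2" by (rule Q0)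
    show "(\<lambda>z. h z + cnj (h z)) \<in> mixed_algebra r"
      by (intro mixed_algebra.intros h)
    show "complex_of_real (remainder_w \<beta> \<gamma> z) = h z + cnj (h z) + of_real (ln (- ln (norm z)))
        - of_real (ln (- ln (norm z) + Re (Q z)))" if z: "z \<in> ball 0 r - {0}" for z
    proof -
      have zz: "z \<in> ball 0 r" "z \<noteq> 0" using z by auto
      have n: "norm (1 - z) > 0" "1 - z \<noteq> 0" using one[OF zz(1)] by auto
      have p: "norm (\<phi> z) > 0" "\<phi> z \<noteq> 0" using P[OF zz(1)] by auto
      define T where "T = - ln (norm z) + Re (Q z)"
      have T: "T > 0" unfolding T_def using M[OF z] .
      have "ln (l z) = - ln (norm z) - \<beta> * ln (norm (1 - z)) - (ln 2 + 2 * ln (norm (\<phi> z)) + ln T)"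
        unfolding l_def T_def[symmetric] using zz n p T
        by (simp add: ln_mult ln_div ln_powr ln_realpow)
      moreover have "ln (1 / norm z) = - ln (norm z)" using zz by (simp add: ln_div)
      ultimately have "remainder_w \<beta> \<gamma> z = - \<beta> * ln (norm (1 - z)) - ln 2 - 2 * ln (norm (\<phi> z))
          + ln (- ln (norm z)) - ln T"
        unfolding remainder_w_def dens[OF z] by simp
      also have "- \<beta> * ln (norm (1 - z)) - ln 2 - 2 * ln (norm (\<phi> z)) = 2 * Re (h z)"
        using n p by (simp add: h_def)
      finally show ?thesis unfolding T_def complex_add_cnj by simp
    qed
  qed
qed

theorem theorem4p1:
  fixes \<beta> \<gamma> a b :: real and w :: "complex \<Rightarrow> complex" and m n :: nat
  assumes "0 < \<beta>" "\<beta> < 1" "0 < \<gamma>" "\<gamma> \<le> 1" "\<beta> + \<gamma> > 1"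
    and "a = (1 + \<beta> - \<gamma>) / 2"
    and "b = (\<beta> + \<gamma> - 1) / 2"
    and "w = (\<lambda>z. complex_of_real (remainder_w \<beta> \<gamma> z))"
    and "m \<ge> 1" "n \<ge> 1"
  shows "((\<lambda>z. z ^ n * of_real ((ln (1 / norm z)) ^ 2) * (wirtinger ^^ n) w z)
            \<longlongrightarrow> of_real ((-1) ^ n * fact (n - 1) / 4 * (G_fun a + G_fun b))) (at 0)
       \<and> ((\<lambda>z. z ^ n * cnj z ^ m * of_real ((ln (1 / norm z)) ^ 3)
                * (wirtinger_bar ^^ m) ((wirtinger ^^ n) w) z)
            \<longlongrightarrow> of_real ((-1) ^ (m + n - 1) * fact (n - 1) * fact (m - 1) / 4
                        * (G_fun a + G_fun b))) (at 0)"
proof -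
  have ab: "0 < a" "a < 1" "0 < b" "b < 1" using assms(1-7) by (simp_all add: field_simps)
  obtain r Q H where lc: "log_comparison r Q" and Q0: "Re (Q 0) = (G_fun a + G_fun b) / 2"
    and H: "H \<in> mixed_algebra r"
    and eq: "\<And>z. z \<in> ball 0 r - {0} \<Longrightarrow> complex_of_real (remainder_w \<beta> \<gamma> z) =
        H z + of_real (ln (- ln (norm z))) - of_real (ln (- ln (norm z) + Re (Q z)))"
    using remainder_w_decomposition[OF ab assms(6,7)] by metis
  interpret log_comparison r Q by (rule lc)
  have w: "w z = H z + of_real (ln (L z)) - of_real (ln (M z))" if "z \<in> D" for z
    using eq[OF that] assms(8) by (simp add: M_def L_def)
  show ?thesis
    using wirtinger_limit[OF Q0 H w assms(10)] wirtinger_bar_limit[OF Q0 H w assms(10,9)] by simp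
qed

end
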